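(* For every $l\in\mathbb N$, the $l$-th spectral curve $\Gamma_l:=\{(\lambda,\mu)\in\mathbb C^2: P_l(\lambda,\mu^2)=0\}$ is an irreducible complex algebraic curve.
   Context: For $l\in\mathbb N$ and $\mu\in\mathbb C$, $H_l$ is the tridiagonal $l\times l$ matrix with entries $H_{l;jj}=(1-j)(l-j+1)$, $H_{l;j,j+1}=\mu j$, $H_{l;j,j-1}=\mu(l-j+1)$, and $H_{l;ij}=0$ if $|i-j|\geq 2$. It is known that $\det(H_l+\lambda\,\mathrm{Id})$ is a polynomial of degree $l$ in $(\lambda,\mu^2)$; it is written $P_l(\lambda,\mu^2)$. *)

theory Defs
  imports "Jordan_Normal_Form.Determinant" "HOL-Computational_Algebra.Polynomial"
begin

text \<open>Entries of H_l with the paper's 1-based indices j, k in 1..l.\<close>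
definition H_entry :: "nat \<Rightarrow> complex \<Rightarrow> nat \<Rightarrow> nat \<Rightarrow> complex" where
  "H_entry l \<mu> j k =
     (if k = j then (1 - of_nat j) * (of_nat l - of_nat j + 1)
      else if k = j + 1 then \<mu> * of_nat j
      else if j = k + 1 then \<mu> * (of_nat l - of_nat j + 1)
      else 0)"

text \<open>The l x l matrix H_l (Jordan_Normal_Form matrices are 0-indexed, so shift by one).\<close>
definition H :: "nat \<Rightarrow> complex \<Rightarrow> complex mat" where
  "H l \<mu> = mat l l (\<lambda>(i, k). H_entry l \<mu> (i + 1) (k + 1))"

text \<open>The spectral curve: zeros of P_l(lambda, mu^2) = det(H_l + lambda Id).\<close>
definition Gamma :: "nat \<Rightarrow> (complex \<times> complex) set" where
  "Gamma l = {(lam, mu). det (H l mu + lam \<cdot>\<^sub>m 1\<^sub>m l) = 0}"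

text \<open>Bivariate complex polynomials are represented as complex poly poly:
  outer variable x (lambda), coefficients polynomials in y (mu).\<close>
definition eval2 :: "complex poly poly \<Rightarrow> complex \<Rightarrow> complex \<Rightarrow> complex" where
  "eval2 p x y = poly (map_poly (\<lambda>c. poly c y) p) x"

definition zero_set :: "complex poly poly set \<Rightarrow> (complex \<times> complex) set" where
  "zero_set S = {(x, y). \<forall>p\<in>S. eval2 p x y = 0}"

definition algebraic_set :: "(complex \<times> complex) set \<Rightarrow> bool" where
  "algebraic_set V \<longleftrightarrow> (\<exists>S. V = zero_set S)"

text \<open>A plane algebraic curve: nonempty zero set of a single nonzero polynomial
  (hence a nonconstant one).\<close>
definition algebraic_curve :: "(complex \<times> complex) set \<Rightarrow> bool" where
  "algebraic_curve V \<longleftrightarrow> V \<noteq> {} \<and> (\<exists>p. p \<noteq> 0 \<and> V = zero_set {p})"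

definition irreducible_algebraic_set :: "(complex \<times> complex) set \<Rightarrow> bool" where
  "irreducible_algebraic_set V \<longleftrightarrow> algebraic_set V \<and> V \<noteq> {} \<and>
     (\<forall>A B. algebraic_set A \<longrightarrow> algebraic_set B \<longrightarrow> V = A \<union> B \<longrightarrow> V = A \<or> V = B)"

end

theory Submission
  imports Defs "HOL-Computational_Algebra.Computational_Algebra"
    "HOL-Computational_Algebra.Field_as_Ring"
begin

text \<open>Put s = mu^2 and let P be det(H_l + lambda Id) as a polynomial in lambda and s. At s = 0 its
  roots are the numbers i(l - i), all double except 0 and, for even l, the top one l^2/4. A factor of P that
  is monic in lambda has roots whose sum grows at most linearly in mu, hence is constant as a
  function of s. On the other hand all roots decrease to first order in s, except at the top: for
  odd l the two top roots form one branch ramified over s = 0, and for even l the two roots just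
  below the top move with the irrational velocities A + delta and A - delta, where
  delta^2 = n^2(n^2 - 1) and n = l/2. So a monic factor avoiding the top has degree 0, and P is irreducible
  in (lambda, s). The origin is a smooth point of the curve, so the factor of P(lambda, mu^2) through it is
  even in mu, and irreducibility carries over to (lambda, mu).\<close>

subsection \<open>Continuants\<close>

text \<open>Constancy of the sum of roots means that the first-order velocities of the roots of a
  factor at s = 0 add up to zero. With N = l^2 - 1, an unsplit root at level z has velocity -(N -
  2z)/(N - 4z), which is -1/2 - (N/8)/(x - z) for x = N/4, the pole of this Moebius function. For a
  factor of degree d restricting to f at s = 0, the velocities thus sum to -d/2 - (N/8) f'(x)/f(x).
  So the contradiction can be read off at the single point x, and no root has to be followed as an
  analytic function of s. The obstacle is that most roots at s = 0 are double, so that a factor may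
  contain one branch or both. With both, the velocities sum to 2A whether or not they split; only a
  single branch of a split pair needs care. Signs do not decide there, since A + delta is positive,
  but every other contribution is rational and delta is not.\<close>

text \<open>With s standing for the square of mu, the continuants are the leading principal minors of
  H_l + lambda Id as polynomials in lambda over C[s]: the diagonal entries and the products of
  opposite off-diagonal entries (divided by s) are given by the same numbers i(l - i). Since the
  value at i = 0 is 0, the truncated k - 1 in the recurrence below is harmless.\<close>

definition level :: "nat \<Rightarrow> nat \<Rightarrow> complex" where
  "level l i = of_nat i * (of_nat l - of_nat i)"

fun continuant :: "nat \<Rightarrow> nat \<Rightarrow> complex poly poly" where
  "continuant l 0 = 1"
| "continuant l (Suc 0) = [:0, 1:]"
| "continuant l (Suc (Suc k)) =
     [:[:- level l (Suc k):], 1:] * continuant l (Suc k) - smult [:0, level l (Suc k):] (continuant l k)"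

lemma continuant_Suc:
  "continuant l (Suc k) = [:[:- level l k:], 1:] * continuant l k - smult [:0, level l k:] (continuant l (k - 1))"
  by (cases k) (auto simp: level_def)

declare continuant.simps(3) [simp del]

text \<open>Restriction to the line lambda = z + u t, s = t, as a polynomial in t. As u varies, its lowest
  coefficients carry the tangent directions of the curve at (z, 0).\<close>

abbreviation line :: "complex poly poly \<Rightarrow> complex \<Rightarrow> complex \<Rightarrow> complex poly" where
  "line q z u \<equiv> poly q [:z, u:]"

lemma line_continuant_Suc:
  "line (continuant l (Suc k)) z u =
     [:z - level l k, u:] * line (continuant l k) z u - [:0, level l k:] * line (continuant l (k - 1)) z u"
  unfolding continuant_Suc by (simp add: algebra_simps smult_diff_left smult_add_left)

section \<open>Low-order expansion of the continuants along a line\<close>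

lemma coeff_linear_mult:
  fixes f :: "'a::comm_ring_1 poly"
  shows "coeff ([:a, b:] * f) 0 = a * coeff f 0"
    and "coeff ([:a, b:] * f) (Suc n) = a * coeff f (Suc n) + b * coeff f n"
  by simp_all

lemma line_continuant_coeffs:
  "coeff (line (continuant l (Suc k)) z u) 0 = (z - level l k) * coeff (line (continuant l k) z u) 0"
  "coeff (line (continuant l (Suc k)) z u) (Suc n) =
     (z - level l k) * coeff (line (continuant l k) z u) (Suc n) + u * coeff (line (continuant l k) z u) n
     - level l k * coeff (line (continuant l (k - 1)) z u) n"
  unfolding line_continuant_Suc by (simp_all only: coeff_linear_mult coeff_diff) simp_all

lemma level_diff_factor: "level (p + q) p - level (p + q) i = (of_nat i - of_nat p) * (of_nat i - of_nat q)"
  unfolding level_def by (simp add: algebra_simps)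

lemma line_continuant_coeff_0:
  "coeff (line (continuant l k) z u) 0 = (\<Prod>i<k. z - level l i)"
proof (induction k)
  case (Suc k)
  then show ?case by (simp add: line_continuant_coeffs(1))
qed simp

lemma line_continuant_coeff_0_eq_0:
  "i < k \<Longrightarrow> coeff (line (continuant l k) (level l i) u) 0 = 0"
  by (auto simp: line_continuant_coeff_0)

lemma of_nat_diff_neq:
  assumes "p + 2 \<le> q"
  shows "(of_nat q - of_nat p + 1 :: complex) \<noteq> 0" "(of_nat q - of_nat p - 1 :: complex) \<noteq> 0"
proof -
  have "(of_nat q - of_nat p + 1 :: complex) = of_nat (q - p + 1)" using assms by (simp add: of_nat_diff)
  then show "(of_nat q - of_nat p + 1 :: complex) \<noteq> 0" by (metis of_nat_eq_0_iff add_is_0 one_neq_zero)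
  have "(of_nat q - of_nat p - 1 :: complex) = of_nat (q - p - 1)" using assms by (simp add: of_nat_diff)
  moreover have "q - p - 1 \<noteq> 0" using assms by simp
  ultimately show "(of_nat q - of_nat p - 1 :: complex) \<noteq> 0" by (simp only: of_nat_eq_0_iff) simp
qed

text \<open>For these \<open>k\<close> the index \<open>p\<close> is present and its mirror image
  \<open>q\<close> is not, so \<open>level l p\<close> is a simple root at s = 0. The two fractions
  are the contributions of the neighbours \<open>p - 1\<close> and \<open>p + 1\<close>, each a
  coupling divided by a gap between levels.\<close>

lemma line_continuant_coeff_1:
  assumes l: "l = p + q" and pq: "p + 2 \<le> q" and k: "p + 2 \<le> k" "k \<le> q" 
  shows "coeff (line (continuant l k) (level l p) u) 1 =
    (\<Prod>i<p. level l p - level l i) * (\<Prod>i=p+1..<k. level l p - level l i) *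
    (u - level l p / (of_nat q - of_nat p + 1) + level l (p + 1) / (of_nat q - of_nat p - 1))"
    (is "_ = ?X * _ * (u - ?a + ?b)")
  using k
proof (induction k rule: dec_induct)
  case base
  let ?y = "\<lambda>k. coeff (line (continuant l k) (level l p) u)"
  note ne = of_nat_diff_neq(1)[OF pq] and ne2 = of_nat_diff_neq(2)[OF pq]
  have xp: "?y p 0 = ?X" by (rule line_continuant_coeff_0)
  \<comment> \<open>For \<open>p = 0\<close> there is no lower neighbour;
    \<open>level l 0 = 0\<close> removes the term in which \<open>p - 1\<close> truncates.\<close>
  have dpx: "level l p * ?y (p - 1) 0 = ?X * ?a"
  proof (cases p)
    case 0
    then show ?thesis by (simp add: level_def)
  next
    case (Suc r)
    have "?y p 0 = (level l p - level l r) * ?y r 0" by (subst (1) Suc) (rule line_continuant_coeffs(1))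
    moreover have "level l p - level l r = of_nat q - of_nat p + 1"
      unfolding l level_diff_factor by (simp add: Suc algebra_simps)
    ultimately have "?X = (of_nat q - of_nat p + 1) * ?y r 0" using xp by (simp only:)
    then have "?y r 0 = ?X / (of_nat q - of_nat p + 1)" by (metis ne nonzero_mult_div_cancel_left)
    then have "level l p * ?y r 0 = ?X * ?a" by (simp only: times_divide_eq_right mult.commute)
    then show ?thesis by (simp only: Suc diff_Suc_1)
  qed
  have y1: "?y (p + 1) 1 = ?X * (u - ?a)"
    using line_continuant_coeffs(2)[of l p "level l p" u 0] dpx xp by (simp add: algebra_simps)
  have x1: "?y (p + 1) 0 = 0"
    using line_continuant_coeff_0_eq_0[of p "p+1" l u] by simp
  have e: "level l p - level l (p + 1) = - (of_nat q - of_nat p - 1)"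
    unfolding l level_diff_factor by (simp add: algebra_simps)
  have "?y (p + 2) 1 = (level l p - level l (p + 1)) * ?X * (u - ?a) - level l (p + 1) * ?X"
  proof -
    have "?y (p + 2) 1 = (level l p - level l (p + 1)) * (?X * (u - ?a)) + u * 0 - level l (p + 1) * ?X"
      using line_continuant_coeffs(2)[of l "p+1" "level l p" u 0] y1 x1 xp by (simp add: numeral_2_eq_2)
    then show ?thesis by (simp only: mult_zero_right add_0_right mult.assoc)
  qed
  also have "\<dots> = ?X * (level l p - level l (p + 1)) * (u - ?a + ?b)"
  proof -
    have *: "- n * X * v - d * X = X * - n * (v + d / n)" if "n \<noteq> 0" for n X v d :: complex
      using that by (simp add: algebra_simps)
    show ?thesis unfolding e by (rule *[OF ne2])
  qed
  finally show ?case by (simp add: numeral_2_eq_2)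
next
  case (step k)
  \<comment> \<open>Both constant terms already contain the vanishing factor of index
    \<open>p\<close>, so a further index only multiplies by its gap.\<close>
  have "coeff (line (continuant l (k - 1)) (level l p) u) 0 = 0" "coeff (line (continuant l k) (level l p) u) 0 = 0"
    using step.hyps by (auto intro!: line_continuant_coeff_0_eq_0)
  then have *: "coeff (line (continuant l (Suc k)) (level l p) u) 1 =
      (level l p - level l k) * coeff (line (continuant l k) (level l p) u) 1"
    using line_continuant_coeffs(2)[of l k "level l p" u 0] by simp
  have IH: "coeff (line (continuant l k) (level l p) u) 1 = ?X * (\<Prod>i=p+1..<k. level l p - level l i) * (u - ?a + ?b)"
    using step by simp
  show ?case unfolding * IH using step.hyps by simp
qed

text \<open>The first-order change in s of the root of the continuant starting at level p, by
  second-order perturbation theory; division by zero does not occur for p + 2 \<open>\<le>\<close> q.\<close>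

definition level_shift :: "nat \<Rightarrow> nat \<Rightarrow> complex" where
  "level_shift p q = level (p + q) p / (of_nat q - of_nat p + 1) - level (p + q) (p + 1) / (of_nat q - of_nat p - 1)"

text \<open>The shift is a Moebius function of the level alone; this is what later turns a statement about
  all roots of a factor into a single polynomial divisibility.\<close>

lemma level_shift_eq:
  assumes "p + 2 \<le> q"
  shows "((of_nat (p + q))^2 - 1 - 4 * level (p + q) p) * level_shift p q = - ((of_nat (p + q))^2 - 1 - 2 * level (p + q) p)"
proof -
  have N: "(of_nat (p + q))^2 - 1 - 4 * level (p + q) p = (of_nat q - of_nat p + 1) * (of_nat q - of_nat p - 1 :: complex)"
    by (simp add: level_def algebra_simps power2_eq_square)
  have *: "(a * b) * (x / a - y / b) = b * x - a * y" if "a \<noteq> 0" "b \<noteq> 0" for a b x y :: complex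
    using that by (simp add: field_simps)
  show ?thesis unfolding N level_shift_def *[OF of_nat_diff_neq[OF assms]]
    by (simp add: level_def algebra_simps power2_eq_square)
qed

text \<open>Once \<open>q\<close> is passed the root is double. As \<open>p\<close> and
  \<open>q\<close> have no common neighbour, they do not interact at this order, and by the symmetry
  i to l - i both move with the same velocity; hence a perfect square.\<close>

lemma line_continuant_coeff_2:
  assumes l: "l = p + q" and pq: "p + 3 \<le> q" and p: "1 \<le> p" and k: "q + 2 \<le> k"
  shows "coeff (line (continuant l k) (level l p) u) 1 = 0"
    "coeff (line (continuant l k) (level l p) u) 2 =
      (\<Prod>i<p. level l p - level l i) * (\<Prod>i=p+1..<q. level l p - level l i) *
      (\<Prod>i=q+1..<k. level l p - level l i) * (u - level_shift p q)^2"
proof -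
  let ?y = "\<lambda>k. coeff (line (continuant l k) (level l p) u)"
  let ?X = "(\<Prod>i<p. level l p - level l i) * (\<Prod>i=p+1..<q. level l p - level l i)"
  have zq: "level l q = level l p" by (simp add: l level_def algebra_simps)
  have x0: "?y j 0 = 0" if "p < j" for j using line_continuant_coeff_0_eq_0[of p j l u] that by simp
  have y0: "?y j 1 = 0" if "q + 1 \<le> j" for j
    using that
  proof (induction j rule: dec_induct)
    case base
    show ?case using line_continuant_coeffs(2)[of l q "level l p" u 0] x0[of q] x0[of "q - 1"] pq zq by simp
  next
    case (step j)
    show ?case using line_continuant_coeffs(2)[of l j "level l p" u 0] x0[of j] x0[of "j - 1"] step pq by simp
  qed
  show "?y k 1 = 0" using y0 k by simp
  have yq: "?y q 1 = ?X * (u - level_shift p q)"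
    using line_continuant_coeff_1[OF l, of q u] pq by (simp add: level_shift_def l algebra_simps)
  have em: "level l p - level l (q - 1) = - (of_nat q - of_nat p - 1)"
    using level_diff_factor[of p q "q - 1"] pq by (simp add: l algebra_simps of_nat_diff)
  have ep: "level l p - level l (q + 1) = of_nat q - of_nat p + 1"
    using level_diff_factor[of p q "q + 1"] by (simp add: l algebra_simps)
  have y1: "?y q 1 = (level l p - level l (q - 1)) * ?y (q - 1) 1"
    using line_continuant_coeffs(2)[of l "q - 1" "level l p" u 0] x0[of "q - 1"] x0[of "q - 1 - 1"] pq by simp
  have ym: "?y (q - 1) 1 = - ?y q 1 / (of_nat q - of_nat p - 1)"
  proof -
    have "?y q 1 = - ((of_nat q - of_nat p - 1) * ?y (q - 1) 1)"
      unfolding y1 em by (rule minus_mult_left[symmetric])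
    moreover have "(of_nat q - of_nat p - 1 :: complex) \<noteq> 0" using of_nat_diff_neq(2)[of p q] pq by simp
    ultimately show ?thesis by (simp only: minus_minus nonzero_mult_div_cancel_left not_False_eq_True)
  qed
  have w1: "?y (q + 1) 2 = u * ?y q 1 - level l p * ?y (q - 1) 1"
    using line_continuant_coeffs(2)[of l q "level l p" u 1] zq by (simp add: numeral_2_eq_2)
  have w2: "?y (q + 2) 2 = (of_nat q - of_nat p + 1) * ?y (q + 1) 2 - level l (q + 1) * ?y q 1"
    using line_continuant_coeffs(2)[of l "q + 1" "level l p" u 1] ep y0[of "q + 1"] by (simp add: numeral_2_eq_2)
  \<comment> \<open>The same shift, now computed from the neighbours \<open>q - 1\<close> and
    \<open>q + 1\<close> of the mirror index.\<close>
  have s: "level_shift p q = - level l p / (of_nat q - of_nat p - 1) + level l (q + 1) / (of_nat q - of_nat p + 1)"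
    unfolding level_shift_def using of_nat_diff_neq[of p q] pq l
    by (simp add: field_simps) (simp add: level_def algebra_simps)
  show "?y k 2 = ?X * (\<Prod>i=q+1..<k. level l p - level l i) * (u - level_shift p q)^2"
    using k
  proof (induction k rule: dec_induct)
    case base
    have "?y (q + 2) 2 = (of_nat q - of_nat p + 1) * ?y q 1 * (u - level_shift p q)"
    proof -
      have *: "b * (v * y - d * (- y / a)) - e * y = b * y * (v - (- d / a + e / b))"
        if "b \<noteq> 0" for a b d e v y :: complex
        using that by (simp add: algebra_simps)
      show ?thesis unfolding w2 w1 ym s by (rule *) (use of_nat_diff_neq[of p q] pq in simp)
    qed
    moreover have "(\<Prod>i=q+1..<q+2. level l p - level l i) = of_nat q - of_nat p + 1"
      using ep by simp
    ultimately show ?case unfolding yq by (simp only: power2_eq_square mult_ac)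
  next
    case (step k)
    have *: "?y (Suc k) 2 = (level l p - level l k) * ?y k 2"
      using line_continuant_coeffs(2)[of l k "level l p" u 1] y0[of k] y0[of "k - 1"] step by (simp add: numeral_2_eq_2)
    show ?case unfolding * step.IH using step.hyps by (simp add: algebra_simps)
  qed
qed

text \<open>Here p and q are joined by a path of length two, which splits the tangent directions.\<close>

lemma line_continuant_coeff_2_adjacent:
  assumes l: "l = p + (p + 2)" and p: "1 \<le> p" and k: "p + 4 \<le> k"
  shows "coeff (line (continuant l k) (level l p) u) 1 = 0"
    "coeff (line (continuant l k) (level l p) u) 2 =
      (\<Prod>i<p. level l p - level l i) * (-3) *
      (\<Prod>i=p+4..<k. level l p - level l i) * ((u - level_shift p (p + 2))^2 - level l p * (level l p + 1))"
proof -
  let ?y = "\<lambda>k. coeff (line (continuant l k) (level l p) u)"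
  let ?X = "(\<Prod>i<p. level l p - level l i)"
  let ?z = "level l p"
  have zq: "level l (p + 2) = level l p" by (simp add: l level_def algebra_simps)
  \<comment> \<open>The splitting term z(z + 1) is the product of the couplings
    \<open>level l (p + 1)\<close> and \<open>level l (p + 2)\<close> along the path, over the
    squared gap 1 to its middle. The factor -3 collects the gaps -1 and 3 to \<open>p + 1\<close>
    and \<open>p + 3\<close>.\<close>
  have z1: "level l (p + 1) = ?z + 1" by (simp add: l level_def algebra_simps)
  have z3: "level l (p + 3) = ?z - 3" by (simp add: l level_def algebra_simps)
  have x0: "?y j 0 = 0" if "p < j" for j using line_continuant_coeff_0_eq_0[of p j l u] that by simp
  have xp: "?y p 0 = ?X" by (rule line_continuant_coeff_0)
  have "?y (Suc (p - 1)) 0 = (?z - level l (p - 1)) * ?y (p - 1) 0" by (rule line_continuant_coeffs(1))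
  moreover have "?z - level l (p - 1) = 3"
    using level_diff_factor[of p "p+2" "p - 1"] p by (simp add: l algebra_simps of_nat_diff)
  ultimately have xm: "?y (p - 1) 0 = ?X / 3" using xp p by simp
  have y1: "?y (p + 1) 1 = ?X * (u - ?z / 3)"
    using line_continuant_coeffs(2)[of l p "level l p" u 0] unfolding xp xm by (simp add: algebra_simps)
  have y2: "?y (p + 2) 1 = - ?X * (u + 2 * ?z / 3 + 1)"
  proof -
    have "?y (p + 2) 1 = (?z - (?z + 1)) * (?X * (u - ?z / 3)) + u * 0 - (?z + 1) * ?X"
      using line_continuant_coeffs(2)[of l "p + 1" "level l p" u 0] y1 z1 xp x0[of "p + 1"]
      by (simp add: numeral_2_eq_2)
    then show ?thesis by (simp add: algebra_simps)
  qed
  have y0: "?y j 1 = 0" if "p + 3 \<le> j" for j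
    using that
  proof (induction j rule: dec_induct)
    case base
    show ?case using line_continuant_coeffs(2)[of l "p + 2" "level l p" u 0] x0[of "p+2"] x0[of "p+1"] zq
      by (simp add: numeral_3_eq_3)
  next
    case (step j)
    show ?case using line_continuant_coeffs(2)[of l j "level l p" u 0] x0[of j] x0[of "j - 1"] step by simp
  qed
  show "?y k 1 = 0" using y0 k by simp
  have w1: "?y (p + 3) 2 = u * ?y (p + 2) 1 - ?z * ?y (p + 1) 1"
    using line_continuant_coeffs(2)[of l "p + 2" "level l p" u 1] zq by (simp add: numeral_2_eq_2 numeral_3_eq_3)
  have w2: "?y (p + 4) 2 = 3 * ?y (p + 3) 2 - (?z - 3) * ?y (p + 2) 1"
    using line_continuant_coeffs(2)[of l "p + 3" "level l p" u 1] z3 y0[of "p + 3"]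
    by (simp add: eval_nat_numeral)
  have s: "level_shift p (p + 2) = - (2 * ?z + 3) / 3"
    unfolding level_shift_def using l by (simp add: level_def field_simps)
  show "?y k 2 = ?X * (-3) * (\<Prod>i=p+4..<k. level l p - level l i) * ((u - level_shift p (p + 2))^2 - ?z * (?z + 1))"
    using k
  proof (induction k rule: dec_induct)
    case base
    have *: "3 * (u * (- X * (u + 2 * z / 3 + 1)) - z * (X * (u - z / 3))) - (z - 3) * (- X * (u + 2 * z / 3 + 1))
        = X * (-3) * 1 * ((u - - (2 * z + 3) / 3)^2 - z * (z + 1))" for X z :: complex
    proof -
      \<comment> \<open>Clears the denominators, leaving a polynomial identity.\<close>
      define t where "t = z / 3"
      have z: "z = 3 * t" "- (2 * z + 3) / 3 = - (2 * t + 1)" "2 * z / 3 = 2 * t" "z / 3 = t"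
        by (simp_all add: t_def add_divide_distrib)
      show ?thesis unfolding z(2-4) unfolding z(1) by (simp add: algebra_simps power2_eq_square)
    qed
    have "(\<Prod>i=p+4..<p+4. level l p - level l i) = 1" by simp
    then show ?case unfolding w2 w1 y1 y2 s by (simp only: *)
  next
    case (step k)
    have *: "?y (Suc k) 2 = (level l p - level l k) * ?y k 2"
      using line_continuant_coeffs(2)[of l k "level l p" u 1] y0[of k] y0[of "k - 1"] step by (simp add: numeral_2_eq_2)
    show ?case unfolding * step.IH using step.hyps by (simp add: algebra_simps)
  qed
qed

text \<open>The two top indices are adjacent, so they interact at first order already. The result
  does not involve \<open>u\<close> and is nonzero when \<open>k = l\<close> and l > 1: the double
  root at s = 0 is a smooth point of the curve with tangent s = 0.\<close>

lemma line_continuant_coeff_1_middle: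
  assumes l: "l = p + (p + 1)" and k: "p + 2 \<le> k"
  shows "coeff (line (continuant l k) (level l p) u) 1 =
      (\<Prod>i<p. level l p - level l i) * (- level l p) * (\<Prod>i=p+2..<k. level l p - level l i)"
  using k
proof (induction k rule: dec_induct)
  case base
  have z: "level l (p + 1) = level l p" by (simp add: l level_def algebra_simps)
  have "coeff (line (continuant l (p + 1)) (level l p) u) 0 = 0"
    using line_continuant_coeff_0_eq_0[of p "p+1" l u] by simp
  then show ?case using line_continuant_coeffs(2)[of l "p + 1" "level l p" u 0] z line_continuant_coeff_0[of l p "level l p" u]
    by (simp add: eval_nat_numeral)
next
  case (step k)
  have "coeff (line (continuant l (k - 1)) (level l p) u) 0 = 0" "coeff (line (continuant l k) (level l p) u) 0 = 0"
    using step.hyps by (auto intro!: line_continuant_coeff_0_eq_0)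
  then have *: "coeff (line (continuant l (Suc k)) (level l p) u) 1 =
      (level l p - level l k) * coeff (line (continuant l k) (level l p) u) 1"
    using line_continuant_coeffs(2)[of l k "level l p" u 0] by simp
  have IH: "coeff (line (continuant l k) (level l p) u) 1 = (\<Prod>i<p. level l p - level l i) * (- level l p) *
      (\<Prod>i=p+2..<k. level l p - level l i)"
    using step by simp
  show ?case unfolding * IH using step.hyps by simp
qed

text \<open>Only the dependence on \<open>u\<close> matters: the top level is a simple root. Taking
  the difference with \<open>u = 0\<close> avoids computing its velocity.\<close>

lemma line_continuant_coeff_1_top:
  assumes l: "l = p + p" and k: "p + 1 \<le> k"
  shows "coeff (line (continuant l k) (level l p) u) 1 - coeff (line (continuant l k) (level l p) 0) 1 =
      u * (\<Prod>i<p. level l p - level l i) * (\<Prod>i=p+1..<k. level l p - level l i)"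
  using k
proof (induction k rule: dec_induct)
  case base
  show ?case
    using line_continuant_coeffs(2)[of l p "level l p" u 0] line_continuant_coeffs(2)[of l p "level l p" 0 0]
      line_continuant_coeff_0[of l "p - 1" "level l p" 0]
    by (simp add: line_continuant_coeff_0)
next
  case (step k)
  have x0: "coeff (line (continuant l k) (level l p) v) 0 = 0" for v
    using step.hyps by (auto intro!: line_continuant_coeff_0_eq_0)
  have xm: "coeff (line (continuant l (k - 1)) (level l p) u) 0 = coeff (line (continuant l (k - 1)) (level l p) 0) 0"
    by (simp only: line_continuant_coeff_0)
  have *: "coeff (line (continuant l (Suc k)) (level l p) u) 1 - coeff (line (continuant l (Suc k)) (level l p) 0) 1 =
      (level l p - level l k) * (coeff (line (continuant l k) (level l p) u) 1 - coeff (line (continuant l k) (level l p) 0) 1)"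
    using line_continuant_coeffs(2)[of l k "level l p" u 0] line_continuant_coeffs(2)[of l k "level l p" 0 0] x0[of u] x0[of 0] xm
    by (simp add: right_diff_distrib)
  show ?case unfolding * step.IH using step.hyps by simp
qed

lemma level_diff_nonzero:
  assumes "i \<noteq> p" "i \<noteq> q"
  shows "level (p + q) p - level (p + q) i \<noteq> 0"
  unfolding level_diff_factor using assms by simp

subsection \<open>Tangent directions of factors\<close>

definition slice :: "nat \<Rightarrow> complex poly poly \<Rightarrow> complex poly" where
  "slice j q = map_poly (\<lambda>c. coeff c j) q"

lemma coeff_slice: "coeff (slice j q) i = coeff (coeff q i) j"
  by (simp add: slice_def coeff_map_poly)

lemma slice_pCons: "slice j (pCons a q) = pCons (coeff a j) (slice j q)"
  by (simp add: slice_def map_poly_pCons)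

lemma slice_0 [simp]: "slice j 0 = 0"
  by (simp add: slice_def)

lemma line_coeffs:
  "coeff (line q z u) 0 = poly (slice 0 q) z"
  "coeff (line q z u) 1 = poly (pderiv (slice 0 q)) z * u + poly (slice 1 q) z"
  "coeff (line q z u) 2 =
     poly (pderiv (pderiv (slice 0 q))) z / 2 * u^2 + poly (pderiv (slice 1 q)) z * u + poly (slice 2 q) z"
proof (induction q)
  case 0
  { case 1 show ?case by simp next case 2 show ?case by simp next case 3 show ?case by simp }
next
  case (pCons a q)
  { case 1 show ?case using pCons.IH by (simp add: slice_pCons)
  next
    case 2 show ?case using pCons.IH by (simp add: slice_pCons pderiv_pCons algebra_simps)
  next
    case 3 
    have "coeff (line (pCons a q) z u) 2 = coeff a 2 + z * coeff (line q z u) 2 + u * coeff (line q z u) 1"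
      by (simp add: numeral_2_eq_2)
    then show ?case unfolding pCons.IH
      by (simp add: slice_pCons pderiv_pCons pderiv_add algebra_simps power2_eq_square) 
        }
qed

lemma coeff_mult_low:
  fixes f g :: "'a::comm_semiring_0 poly"
  shows "coeff (f * g) 0 = coeff f 0 * coeff g 0"
    "coeff (f * g) 1 = coeff f 0 * coeff g 1 + coeff f 1 * coeff g 0"
    "coeff (f * g) 2 = coeff f 0 * coeff g 2 + coeff f 1 * coeff g 1 + coeff f 2 * coeff g 0"
  by (simp_all add: coeff_mult numeral_2_eq_2 add_ac)

lemma affine_fun_eq_0:
  fixes a b :: complex
  assumes "\<And>u. a * u + b = 0"
  shows "a = 0 \<and> b = 0"
  using assms[of 0] assms[of 1] by simp

lemma quadratic_fun_eq:
  fixes a b c :: complex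
  assumes "\<And>u. a * u^2 + b * u + c = a' * u^2 + b' * u + c'"
  shows "a = a'" "b = b'" "c = c'"
proof -
  have c: "c = c'" using assms[of 0] by simp
  then have 1: "a + b = a' + b'" using assms[of 1] by simp
  have 2: "a - b = a' - b'" using assms[of "-1"] c by simp
  have "2 * a = 2 * a'" using arg_cong2[OF 1 2, of "(+)"] by simp
  then show "a = a'" by simp
  then show "b = b'" using 1 by simp
  show "c = c'" by fact
qed

text \<open>The quadratic tangent cone at the double point is shared between \<open>F\<close> and
  \<open>G\<close>. Either \<open>G\<close> misses the point and \<open>F\<close> carries the whole
  cone, both velocities averaging to \<open>A\<close>; or each takes one line and \<open>F\<close>
  has a simple root with velocity \<phi>.\<close>

lemma double_point_factor:
  fixes F G :: "complex poly poly"
  assumes c1: "\<And>u. coeff (line (F * G) z u) 1 = 0"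
    and c2: "\<And>u. coeff (line (F * G) z u) 2 = C * ((u - A)^2 - k)"
    and C: "C \<noteq> 0" and f0: "poly (slice 0 F) z = 0"
  shows "(poly (pderiv (slice 0 F)) z = 0 \<and> poly (pderiv (pderiv (slice 0 F))) z \<noteq> 0 \<and>
          poly (slice 1 F) z = 0 \<and> poly (pderiv (slice 1 F)) z = - A * poly (pderiv (pderiv (slice 0 F))) z)
    \<or> (poly (pderiv (slice 0 F)) z \<noteq> 0 \<and>
       (\<exists>\<phi>. poly (slice 1 F) z = - \<phi> * poly (pderiv (slice 0 F)) z \<and> (\<phi> - A)^2 = k))"
proof (cases "poly (slice 0 G) z = 0")
  case False
  let ?g = "poly (slice 0 G) z"
  have "(poly (pderiv (slice 0 F)) z * u + poly (slice 1 F) z) * ?g = 0" for u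
    using c1[of u] f0 unfolding poly_mult coeff_mult_low line_coeffs by simp
  then have "poly (pderiv (slice 0 F)) z * u + poly (slice 1 F) z = 0" for u
    using False by simp
  from affine_fun_eq_0[OF this]
  have f0': "poly (pderiv (slice 0 F)) z = 0" and f1: "poly (slice 1 F) z = 0" by simp_all
  have "(poly (pderiv (pderiv (slice 0 F))) z / 2 * u^2 + poly (pderiv (slice 1 F)) z * u + poly (slice 2 F) z) * ?g
      = C * ((u - A)^2 - k)" for u
    using c2[of u] f0 f0' f1 unfolding poly_mult coeff_mult_low line_coeffs by simp
  note e = this
  have "(poly (pderiv (pderiv (slice 0 F))) z / 2 * ?g) * u^2 + (poly (pderiv (slice 1 F)) z * ?g) * u + poly (slice 2 F) z * ?g
      = C * u^2 + (- 2 * A * C) * u + C * (A^2 - k)" for u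
    using e[of u] by (simp add: algebra_simps power2_eq_square)
  note q = quadratic_fun_eq(1)[OF this] quadratic_fun_eq(2)[OF this]
  have "poly (pderiv (pderiv (slice 0 F))) z \<noteq> 0" using q(1) C by auto
  moreover have "poly (pderiv (slice 1 F)) z * ?g = - A * poly (pderiv (pderiv (slice 0 F))) z * ?g"
    using q(2) q(1)[symmetric] by simp
  ultimately show ?thesis using f0' f1 False mult_right_cancel by blast
next
  case True
  have p: "(poly (pderiv (slice 0 F)) z * u + poly (slice 1 F) z) * (poly (pderiv (slice 0 G)) z * u + poly (slice 1 G) z)
      = C * ((u - A)^2 - k)" for u
    using c2[of u] f0 True unfolding poly_mult coeff_mult_low line_coeffs by simp
  then have "(poly (pderiv (slice 0 F)) z * poly (pderiv (slice 0 G)) z) * u^2 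
      + (poly (pderiv (slice 0 F)) z * poly (slice 1 G) z + poly (slice 1 F) z * poly (pderiv (slice 0 G)) z) * u
      + poly (slice 1 F) z * poly (slice 1 G) z
      = C * u^2 + (- 2 * A * C) * u + C * (A^2 - k)" for u
    using p[of u] by (simp add: algebra_simps power2_eq_square)
  from quadratic_fun_eq(1)[OF this] have nz: "poly (pderiv (slice 0 F)) z \<noteq> 0" using C by auto
  define \<phi> where "\<phi> = - poly (slice 1 F) z / poly (pderiv (slice 0 F)) z"
  have e: "poly (slice 1 F) z = - \<phi> * poly (pderiv (slice 0 F)) z" using nz by (simp add: \<phi>_def)
  \<comment> \<open>At \<open>u\<close> = \<phi> the linear form of \<open>F\<close> vanishes, and
    with it the cone.\<close>
  have "(\<phi> - A)^2 = k" using p[of \<phi>] C unfolding e by simp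
  then show ?thesis using nz e by auto
qed

lemma simple_point_factor:
  fixes F G :: "complex poly poly"
  assumes c1: "\<And>u. coeff (line (F * G) z u) 1 = C * (u - A)"
    and C: "C \<noteq> 0" and f0: "poly (slice 0 F) z = 0"
  shows "poly (pderiv (slice 0 F)) z \<noteq> 0 \<and> poly (slice 1 F) z = - A * poly (pderiv (slice 0 F)) z"
proof -
  let ?g = "poly (slice 0 G) z"
  have "(poly (pderiv (slice 0 F)) z * u + poly (slice 1 F) z) * ?g = C * (u - A)" for u
    using c1[of u] f0 unfolding poly_mult coeff_mult_low line_coeffs by simp
  then have "0 * u^2 + (poly (pderiv (slice 0 F)) z * ?g) * u + poly (slice 1 F) z * ?g = 0 * u^2 + C * u + (- C * A)" for u
    by (simp add: algebra_simps)
  note q = quadratic_fun_eq(2)[OF this] quadratic_fun_eq(3)[OF this]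
  have g: "?g \<noteq> 0" using q(1) C by auto
  have "poly (slice 1 F) z * ?g = - A * poly (pderiv (slice 0 F)) z * ?g"
    using q(2) q(1)[symmetric] by simp
  then have "poly (slice 1 F) z = - A * poly (pderiv (slice 0 F)) z" using g mult_right_cancel by blast
  then show ?thesis using q(1) C by auto
qed

section \<open>Divisibility tested root by root\<close>

lemma pow_order_dvd_simple:
  fixes f r :: "complex poly"
  assumes "poly (pderiv f) z \<noteq> 0" "poly r z = 0"
  shows "[:-z, 1:] ^ order z f dvd r"
proof -
  have "order z f \<le> 1"
  proof (rule ccontr)
    assume "\<not> order z f \<le> 1"
    then have "[:-z, 1:] ^ 2 dvd f" using le_imp_power_dvd[of 2 "order z f" "[:-z,1:]"] order_1[of z f] dvd_trans by force
    then obtain g where "f = [:-z, 1:] ^ 2 * g" by (elim dvdE)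
    then have "f = [:-z,1:] * ([:-z,1:] * g)" by (simp only: power2_eq_square mult.assoc)
    then have "poly (pderiv f) z = 0" by (simp only: pderiv_mult poly_add poly_mult) simp
    then show False using assms(1) by simp
  qed
  then have "[:-z, 1:] ^ order z f dvd [:-z, 1:] ^ 1" by (rule le_imp_power_dvd)
  also have "\<dots> dvd r" using assms(2) by (simp add: poly_eq_0_iff_dvd)
  finally show ?thesis .
qed

lemma pow_order_dvd_double:
  fixes f r :: "complex poly"
  assumes "poly (pderiv (pderiv f)) z \<noteq> 0" "poly r z = 0" "poly (pderiv r) z = 0"
  shows "[:-z, 1:] ^ order z f dvd r"
proof -
  have "order z f \<le> 2"
  proof (rule ccontr)
    assume "\<not> order z f \<le> 2"
    then have "[:-z, 1:] ^ 3 dvd f" using le_imp_power_dvd[of 3 "order z f" "[:-z,1:]"] order_1[of z f] dvd_trans by force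
    then obtain g where "f = [:-z, 1:] ^ 3 * g" by (elim dvdE)
    then have "f = [:-z,1:] * ([:-z,1:] * ([:-z,1:] * g))" by (simp only: power3_eq_cube mult.assoc)
    then have "poly (pderiv (pderiv f)) z = 0" by (simp only: pderiv_mult pderiv_add poly_add poly_mult) simp
    then show False using assms(1) by simp
  qed
  then have "[:-z, 1:] ^ order z f dvd [:-z, 1:] ^ 2" by (rule le_imp_power_dvd)
  also obtain s where s: "r = [:-z, 1:] * s" using assms(2) by (auto simp: poly_eq_0_iff_dvd elim: dvdE)
  have "poly s z = 0" using assms(3) unfolding s pderiv_mult by (simp add: pderiv_pCons)
  then obtain t where "s = [:-z, 1:] * t" by (auto simp: poly_eq_0_iff_dvd elim: dvdE)
  then have "[:-z, 1:] ^ 2 dvd r" unfolding s by (simp only: power2_eq_square mult.assoc[symmetric] dvd_triv_left)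
  finally show ?thesis .
qed

lemma order_le_imp_dvd:
  fixes f r :: "complex poly"
  assumes "f \<noteq> 0" "r \<noteq> 0" "\<And>z. order z f \<le> order z r"
  shows "f dvd r"
  using assms
proof (induction "degree f" arbitrary: f r)
  case 0
  then show ?case by (simp add: is_unit_iff_degree unit_imp_dvd)
next
  case (Suc n)
  have "\<not> constant (poly f)" using Suc.hyps(2) by (simp add: constant_degree)
  then obtain z where z: "poly f z = 0" using fundamental_theorem_of_algebra by blast
  then have "order z f \<noteq> 0" using Suc.prems(1) by (simp add: order_root)
  then have "order z r \<noteq> 0" using Suc.prems(3)[of z] by simp
  then have "poly r z = 0" using order_root by blast
  then obtain s where s: "r = [:-z, 1:] * s" by (auto simp: poly_eq_0_iff_dvd elim: dvdE)
  obtain g where g: "f = [:-z, 1:] * g" using z by (auto simp: poly_eq_0_iff_dvd elim: dvdE)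
  have nz: "g \<noteq> 0" "s \<noteq> 0" "[:-z, 1:] * g \<noteq> 0" "[:-z, 1:] * s \<noteq> 0"
    using Suc.prems(1,2) g s by auto
  have "degree f = Suc (degree g)" unfolding g using nz by (simp add: degree_mult_eq del: mult_pCons_left)
  then have "n = degree g" using Suc.hyps(2) by simp
  moreover have "order w g \<le> order w s" for w
    using Suc.prems(3)[of w] unfolding g s order_mult[OF nz(3)] order_mult[OF nz(4)] by simp
  ultimately have "g dvd s" using Suc.hyps(1)[of g s] nz by simp
  then show ?case unfolding g s by (rule mult_dvd_mono[OF dvd_refl])
qed

lemma dvd_if_pow_order_dvd:
  fixes f r :: "complex poly"
  assumes f: "f \<noteq> 0" and "\<And>z. poly f z = 0 \<Longrightarrow> [:-z, 1:] ^ order z f dvd r"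
  shows "f dvd r"
proof (cases "r = 0")
  case False
  have "order z f \<le> order z r" for z
  proof (cases "poly f z = 0")
    case True
    then show ?thesis using assms(2)[OF True] False by (simp add: order_divides)
  next
    case nz: False
    then show ?thesis by (simp add: order_0I)
  qed
  then show ?thesis using order_le_imp_dvd[OF f False] by simp
qed simp

section \<open>Divisibility of the shift defect by a factor at s = 0\<close>

lemma level_self [simp]: "level l l = 0" by (simp add: level_def)

lemma level_0 [simp]: "level l 0 = 0" by (simp add: level_def)

lemma level_nonzero: "0 < i \<Longrightarrow> i < l \<Longrightarrow> level l i \<noteq> 0"
  by (simp add: level_def)

text \<open>Stepping to index l + 1 only multiplies by the nonzero constant level l p, since level l l = 0;
  this avoids a separate treatment of p = 1, where q + 2 exceeds l.\<close>

lemma line_continuant_full: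
  assumes l: "l = p + q" and p: "1 \<le> p" and pq: "p + 2 \<le> q"
  obtains C where "C \<noteq> 0" "\<And>u. coeff (line (continuant l l) (level l p) u) 1 = 0"
    "\<And>u. coeff (line (continuant l l) (level l p) u) 2 =
       C * ((u - level_shift p q)^2 - (if q = p + 2 then level l p * (level l p + 1) else 0))"
proof -
  let ?z = "level l p"
  have z: "?z \<noteq> 0" using level_nonzero[of p l] l p pq by simp
  have x: "coeff (line (continuant l l) ?z u) 0 = 0" for u
    using line_continuant_coeff_0_eq_0[of p l l u] l p pq by simp
  have y: "coeff (line (continuant l (Suc l)) ?z u) 1 = ?z * coeff (line (continuant l l) ?z u) 1" for u
    using line_continuant_coeffs(2)[of l l ?z u 0] x[of u] by simp
  have w: "coeff (line (continuant l (Suc l)) ?z u) 2 = ?z * coeff (line (continuant l l) ?z u) 2"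
    if "coeff (line (continuant l l) ?z u) 1 = 0" for u
    using line_continuant_coeffs(2)[of l l ?z u 1] that by (simp add: numeral_2_eq_2)
  have ne: "level l p - level l i \<noteq> 0" if "i \<noteq> p" "i \<noteq> q" for i
    unfolding l by (rule level_diff_nonzero) (use that in simp_all)
  show thesis
  proof (cases "q = p + 2")
    case True
    define C where "C = (\<Prod>i<p. level l p - level l i) * (-3) * (\<Prod>i=p+4..<Suc l. level l p - level l i)"
    have C: "C \<noteq> 0" unfolding C_def using ne True z by (simp add: prod_zero_iff)
    have a: "coeff (line (continuant l (Suc l)) ?z u) 1 = 0"
      "coeff (line (continuant l (Suc l)) ?z u) 2 = C * ((u - level_shift p q)^2 - ?z * (?z + 1))" for u
      using line_continuant_coeff_2_adjacent[of l p "Suc l" u] l p unfolding C_def True by simp_all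
    have b: "coeff (line (continuant l l) ?z u) 1 = 0" for u using a(1)[of u] y[of u] z by simp
    show thesis
      by (rule that[of "C / ?z"])
        (use C z b w a(2) True in \<open>simp_all add: field_simps\<close>)
  next
    case False
    define C where "C = (\<Prod>i<p. level l p - level l i) * (\<Prod>i=p+1..<q. level l p - level l i) * (\<Prod>i=q+1..<Suc l. level l p - level l i)"
    have C: "C \<noteq> 0" unfolding C_def using ne pq z by (simp add: prod_zero_iff)
    have a: "coeff (line (continuant l (Suc l)) ?z u) 1 = 0"
      "coeff (line (continuant l (Suc l)) ?z u) 2 = C * (u - level_shift p q)^2" for u
      using line_continuant_coeff_2[of l p q "Suc l" u] l p pq False unfolding C_def by simp_all
    have b: "coeff (line (continuant l l) ?z u) 1 = 0" for u using a(1)[of u] y[of u] z by simp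
    show thesis
      by (rule that[of "C / ?z"])
        (use C z b w a(2) False in \<open>simp_all add: field_simps\<close>)
  qed
qed

lemma line_continuant_full_0:
  assumes "2 \<le> l"
  obtains C where "C \<noteq> 0" "\<And>u. coeff (line (continuant l l) (level l 0) u) 1 = C * (u - level_shift 0 l)"
proof -
  have ne: "level l 0 - level l i \<noteq> 0" if "i \<noteq> 0" "i \<noteq> l" for i
    using level_diff_nonzero[of i 0 l] that by simp
  show thesis
    by (rule that[of "\<Prod>i=1..<l. level l 0 - level l i"])
      (use line_continuant_coeff_1[of l 0 l l] assms level_nonzero in \<open>auto simp: level_shift_def prod_zero_iff\<close>)
qed

lemma slice_0_mult: "slice 0 (F * G) = slice 0 F * slice 0 G"
proof -
  have "poly (slice 0 (F * G)) z = poly (slice 0 F * slice 0 G) z" for z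
    using line_coeffs(1)[of "F * G" z 0] line_coeffs(1)[of F z 0] line_coeffs(1)[of G z 0]
    by (simp only: poly_mult coeff_mult_low(1))
  then show ?thesis by (simp add: poly_eq_poly_eq_iff[symmetric] fun_eq_iff)
qed

lemma poly_slice_0_continuant: "poly (slice 0 (continuant l k)) z = (\<Prod>i<k. z - level l i)"
  using line_coeffs(1)[of "continuant l k" z 0] line_continuant_coeff_0[of l k z 0] by simp

text \<open>The symmetry i to l - i allows an index in the lower half; excluding the top level then
  leaves two indices of room for either parity of \<open>l\<close>, as the velocity formula
  requires.\<close>

lemma slice_0_factor_root:
  assumes FG: "F * G = continuant l l" and top: "poly (slice 0 F) (level l (l div 2)) \<noteq> 0"
    and z: "poly (slice 0 F) z = 0"
  obtains p where "z = level l p" "2 * p + 2 \<le> l"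
proof -
  have "poly (slice 0 (continuant l l)) z = 0" unfolding FG[symmetric] slice_0_mult by (simp add: z)
  then obtain i where i: "i < l" "z = level l i" by (auto simp: poly_slice_0_continuant)
  have s: "level l (l - i) = level l i" using i by (simp add: level_def of_nat_diff algebra_simps)
  define p where "p = min i (l - i)"
  have p: "z = level l p" "2 * p \<le> l" using i s by (auto simp: p_def min_def)
  have "p \<noteq> l div 2" using top z p(1) by auto
  then have "2 * p + 2 \<le> l" using p(2) by linarith
  then show thesis using that p(1) by blast
qed

text \<open>Vanishes modulo f if every root of f moves by its level shift, f and g being the coefficients
  of s^0 and s^1 of a factor.\<close>

definition shift_defect :: "nat \<Rightarrow> complex poly \<Rightarrow> complex poly \<Rightarrow> complex poly" where
  "shift_defect l f g = [:(of_nat l)^2 - 1, -4:] * g - [:(of_nat l)^2 - 1, -2:] * pderiv f"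

lemma poly_shift_defect:
  "poly (shift_defect l f g) z = ((of_nat l)^2 - 1 - 4 * z) * poly g z - ((of_nat l)^2 - 1 - 2 * z) * poly (pderiv f) z"
  by (simp add: shift_defect_def algebra_simps)

lemma poly_pderiv_shift_defect:
  "poly (pderiv (shift_defect l f g)) z = ((of_nat l)^2 - 1 - 4 * z) * poly (pderiv g) z - 4 * poly g z
     - ((of_nat l)^2 - 1 - 2 * z) * poly (pderiv (pderiv f)) z + 2 * poly (pderiv f) z"
  unfolding shift_defect_def pderiv_diff pderiv_mult poly_diff poly_add poly_mult
  by (simp add: pderiv_pCons algebra_simps)

lemma level_shift_eq':
  assumes "2 * p + 2 \<le> l"
  shows "((of_nat l)^2 - 1 - 4 * level l p) * level_shift p (l - p) = - ((of_nat l)^2 - 1 - 2 * level l p)"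
  using level_shift_eq[of p "l - p"] assms by simp

text \<open>If \<open>F\<close> contains both branches at a double root, the sum of their velocities
  is as in the unsplit case and the defect vanishes doubly, even for a split pair. The exception is
  therefore exactly one branch of the pair below the top for even \<open>l\<close>.\<close>

lemma local_divisibility:
  assumes FG: "F * G = continuant l l" and p: "2 * p + 2 \<le> l" and z: "poly (slice 0 F) (level l p) = 0"
  shows "[:- level l p, 1:] ^ order (level l p) (slice 0 F) dvd shift_defect l (slice 0 F) (slice 1 F) \<or>
    (1 \<le> p \<and> l = 2 * p + 2 \<and> poly (pderiv (slice 0 F)) (level l p) \<noteq> 0 \<and>
      (\<exists>\<delta>. \<delta>^2 = level l p * (level l p + 1) \<and>
        poly (slice 1 F) (level l p) = - (\<delta> + level_shift p (l - p)) * poly (pderiv (slice 0 F)) (level l p)))"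
proof -
  let ?z = "level l p" and ?A = "level_shift p (l - p)"
  note s = level_shift_eq'[OF p]
  have res0: "poly (shift_defect l (slice 0 F) (slice 1 F)) ?z = 0"
    if "poly (slice 1 F) ?z = - ?A * poly (pderiv (slice 0 F)) ?z"
  proof -
    have "poly (shift_defect l (slice 0 F) (slice 1 F)) ?z =
      - (((of_nat l)^2 - 1 - 4 * ?z) * ?A + ((of_nat l)^2 - 1 - 2 * ?z)) * poly (pderiv (slice 0 F)) ?z"
      unfolding poly_shift_defect that by (simp add: algebra_simps)
    then show ?thesis unfolding s by simp
  qed
  show ?thesis
  proof (cases "p = 0")
    case True
    obtain C where C: "C \<noteq> 0" "\<And>u. coeff (line (continuant l l) (level l 0) u) 1 = C * (u - level_shift 0 l)"
      by (rule line_continuant_full_0[of l]) (use p in auto)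
    have "poly (pderiv (slice 0 F)) ?z \<noteq> 0 \<and> poly (slice 1 F) ?z = - ?A * poly (pderiv (slice 0 F)) ?z"
      by (rule simple_point_factor[of F G _ C]) (use C FG z True in auto)
    then show ?thesis using pow_order_dvd_simple res0 by blast
  next
    case False
    define q where "q = l - p"
    have q: "l = p + q" "1 \<le> p" "p + 2 \<le> q" using p False by (auto simp: q_def)
    have qp: "q = p + 2 \<longleftrightarrow> l = 2 * p + 2" using q by auto
    obtain C where C: "C \<noteq> 0" "\<And>u. coeff (line (continuant l l) ?z u) 1 = 0"
      "\<And>u. coeff (line (continuant l l) ?z u) 2 = C * ((u - ?A)^2 - (if q = p + 2 then ?z * (?z + 1) else 0))"
      by (rule line_continuant_full[OF q]) (auto simp: q_def)
    define k where "k = (if q = p + 2 then ?z * (?z + 1) else 0)"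
    consider (d) "poly (pderiv (slice 0 F)) ?z = 0" "poly (pderiv (pderiv (slice 0 F))) ?z \<noteq> 0"
          "poly (slice 1 F) ?z = 0" "poly (pderiv (slice 1 F)) ?z = - ?A * poly (pderiv (pderiv (slice 0 F))) ?z"
      | (s) \<phi> where "poly (pderiv (slice 0 F)) ?z \<noteq> 0"
          "poly (slice 1 F) ?z = - \<phi> * poly (pderiv (slice 0 F)) ?z" "(\<phi> - ?A)^2 = k"
      using double_point_factor[of F G ?z C ?A k] C z FG unfolding k_def by auto
    then show ?thesis
    proof cases
      case d
      have "poly (pderiv (shift_defect l (slice 0 F) (slice 1 F))) ?z =
        - (((of_nat l)^2 - 1 - 4 * ?z) * ?A + ((of_nat l)^2 - 1 - 2 * ?z)) * poly (pderiv (pderiv (slice 0 F))) ?z"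
        unfolding poly_pderiv_shift_defect d by (simp add: algebra_simps)
      then have "poly (pderiv (shift_defect l (slice 0 F) (slice 1 F))) ?z = 0" unfolding s by simp
      moreover have "poly (shift_defect l (slice 0 F) (slice 1 F)) ?z = 0" by (rule res0) (simp add: d(1) d(3)[unfolded One_nat_def])
      ultimately show ?thesis using pow_order_dvd_double d(2) by blast
    next
      case (s \<phi>)
      show ?thesis
      proof (cases "q = p + 2")
        case True
        have "(\<phi> - ?A)^2 = ?z * (?z + 1)" using s(3) True by (simp add: k_def)
        moreover have "poly (slice 1 F) ?z = - ((\<phi> - ?A) + ?A) * poly (pderiv (slice 0 F)) ?z" using s(2) by simp
        ultimately show ?thesis using q(2) s(1) True qp by blast
      next
        case False
        then have "\<phi> = ?A" using s(3) by (simp add: k_def)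
        then show ?thesis using pow_order_dvd_simple[OF s(1)] res0 s(2) by blast
      qed
    qed
  qed
qed

text \<open>The exceptional root is corrected by a multiple of its cofactor \<open>h\<close>, which
  vanishes to full order at all other roots of the factor and equals f' at this one.\<close>

lemma slice_dvd_shift_defect:
  assumes FG: "F * G = continuant l l" and top: "poly (slice 0 F) (level l (l div 2)) \<noteq> 0"
  shows "slice 0 F dvd shift_defect l (slice 0 F) (slice 1 F) \<or>
    (\<exists>p h \<delta>. 1 \<le> p \<and> l = 2 * p + 2 \<and> slice 0 F = [:- level l p, 1:] * h \<and>
      \<delta>^2 = level l p * (level l p + 1) \<and> slice 0 F dvd shift_defect l (slice 0 F) (slice 1 F) + smult (3 * \<delta>) h)"
proof -
  let ?f = "slice 0 F" and ?r = "shift_defect l (slice 0 F) (slice 1 F)"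
  have f: "?f \<noteq> 0" using top by auto
  show ?thesis
  proof (cases "\<forall>p. 2 * p + 2 \<le> l \<longrightarrow> poly ?f (level l p) = 0 \<longrightarrow> [:- level l p, 1:] ^ order (level l p) ?f dvd ?r")
    case True
    have "?f dvd ?r"
    proof (rule dvd_if_pow_order_dvd[OF f])
      fix z assume z: "poly ?f z = 0"
      obtain p where "z = level l p" "2 * p + 2 \<le> l" by (rule slice_0_factor_root[OF FG top z])
      then show "[:- z, 1:] ^ order z ?f dvd ?r" using True z by auto
    qed
    then show ?thesis ..
  next
    case False
    then obtain p where p: "2 * p + 2 \<le> l" "poly ?f (level l p) = 0" "\<not> [:- level l p, 1:] ^ order (level l p) ?f dvd ?r"
      by blast
    from local_divisibility[OF FG p(1,2)] p(3) obtain \<delta> where d: "1 \<le> p" "l = 2 * p + 2"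
      "poly (pderiv ?f) (level l p) \<noteq> 0" "\<delta>^2 = level l p * (level l p + 1)"
      "poly (slice 1 F) (level l p) = - (\<delta> + level_shift p (l - p)) * poly (pderiv ?f) (level l p)" by blast
    obtain h where h: "?f = [:- level l p, 1:] * h" using p(2) by (auto simp: poly_eq_0_iff_dvd elim: dvdE)
    have hz: "poly h (level l p) = poly (pderiv ?f) (level l p)" unfolding h pderiv_mult by (simp add: pderiv_pCons)
    have "?f dvd ?r + smult (3 * \<delta>) h"
    proof (rule dvd_if_pow_order_dvd[OF f])
      fix z assume z: "poly ?f z = 0"
      obtain p' where p': "z = level l p'" "2 * p' + 2 \<le> l" by (rule slice_0_factor_root[OF FG top z])
      show "[:- z, 1:] ^ order z ?f dvd ?r + smult (3 * \<delta>) h"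
      proof (cases "p' = p")
        case True
        \<comment> \<open>This is the origin of the 3 in the correction term: a deviation \<delta>
          of the velocity changes the defect by -3 \<delta> f'.\<close>
        have n: "(of_nat l)^2 - 1 - 4 * level l p = 3"
          by (simp add: d(2) level_def algebra_simps power2_eq_square)
        have "poly ?r (level l p) = - (((of_nat l)^2 - 1 - 4 * level l p) * level_shift p (l - p) + ((of_nat l)^2 - 1 - 2 * level l p))
            * poly (pderiv ?f) (level l p) - ((of_nat l)^2 - 1 - 4 * level l p) * \<delta> * poly (pderiv ?f) (level l p)"
          unfolding poly_shift_defect d(5) by (simp add: algebra_simps)
        then have "poly ?r (level l p) = - 3 * \<delta> * poly (pderiv ?f) (level l p)"
          unfolding level_shift_eq'[OF p(1)] unfolding n by simp
        then have "poly (?r + smult (3 * \<delta>) h) (level l p) = 0" using hz by simp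
        then show ?thesis unfolding p' True by (rule pow_order_dvd_simple[OF d(3)])
      next
        case False
        have ne: "z \<noteq> level l p"
        proof
          assume "z = level l p"
          moreover have "p' + p < l" using d(2) p'(2) False by linarith
          ultimately show False using level_diff_nonzero[of p' p "p + 2"] p'(1) d(2) False by (auto simp: mult_2)
        qed
        have h0: "[:- level l p, 1:] * h \<noteq> 0" using f h by simp
        have "order z [:- level l p, 1:] = 0" using ne by (intro order_0I) simp
        then have "order z ?f = order z h" unfolding h order_mult[OF h0] by simp
        then have "[:- z, 1:] ^ order z ?f dvd smult (3 * \<delta>) h" using order_1[of z h] by (simp add: dvd_smult)
        moreover have "[:- z, 1:] ^ order z ?f dvd ?r"
          using local_divisibility[OF FG p'(2)] z p'(1) False d(2) by auto
        ultimately show ?thesis by (rule dvd_add[rotated])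
      qed
    qed
    then show ?thesis using d(1,2,4) h by blast
  qed
qed

text \<open>The vanishing coefficient of \<open>g\<close> keeps the degree at most \<open>d\<close>,
  so the quotient by \<open>f\<close> is a constant. Its value comes from the term 2z f', the only
  one to reach degree \<open>d\<close>.\<close>

lemma shift_defect_eq:
  assumes f: "lead_coeff f = 1" "degree f = d" "1 \<le> d" and g: "degree g < d" "coeff g (d - 1) = 0"
    and h: "degree h < d" and dv: "f dvd shift_defect l f g + h"
  shows "shift_defect l f g + h = smult (2 * of_nat d) f"
proof -
  obtain e where e: "d = Suc e" using f(3) by (cases d) auto
  have fd: "coeff f (Suc e) = 1" "\<And>i. Suc e < i \<Longrightarrow> coeff f i = 0"
    using f e by (auto intro: coeff_eq_0)
  have gd: "coeff g i = 0" if "e \<le> i" for i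
    using g e that by (cases "i = e") (auto intro: coeff_eq_0)
  have hd: "\<And>i. e < i \<Longrightarrow> coeff h i = 0" using h e by (intro coeff_eq_0) simp
  have c: "coeff (shift_defect l f g + h) (Suc i) =
    ((of_nat l)^2 - 1) * coeff g (Suc i) - 4 * coeff g i
     - (((of_nat l)^2 - 1) * coeff (pderiv f) (Suc i) - 2 * coeff (pderiv f) i) + coeff h (Suc i)" for i
    unfolding shift_defect_def coeff_add coeff_diff coeff_linear_mult by simp
  have top: "coeff (shift_defect l f g + h) d = 2 * of_nat d"
    unfolding e c using fd gd hd by (simp add: coeff_pderiv)
  have high: "coeff (shift_defect l f g + h) i = 0" if "d < i" for i
  proof -
    define j where "j = i - 1"
    have j: "i = Suc j" using that by (simp add: j_def)
    have ej: "e < j" using that e j by simp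
    show ?thesis unfolding j c using fd(2) gd hd ej by (simp add: coeff_pderiv)
  qed
  obtain k where k: "shift_defect l f g + h = f * k" using dv by (elim dvdE)
  have nz: "k \<noteq> 0" using top k f(3) by auto
  have fnz: "f \<noteq> 0" using f(1) by auto
  have "degree (f * k) \<le> d" unfolding k[symmetric] using high by (intro degree_le) auto
  then have "degree k = 0" using degree_mult_eq[OF fnz nz] f(2) by simp
  then obtain a where a: "k = [:a:]" using degree_eq_zeroE by blast
  have "a = 2 * of_nat d" using top f(1,2) unfolding k a by simp
  then show ?thesis unfolding k a by (simp add: mult.commute)
qed

text \<open>Splitting off one linear factor at a time, values and derivatives at \<open>x\<close>
  are built from the positive rational gaps x - z by sums and products.\<close>

lemma real_rooted_values:
  fixes x :: complex and f :: "complex poly"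
  assumes "f \<noteq> 0" "lead_coeff f = 1" and roots: "\<And>z. poly f z = 0 \<Longrightarrow> \<exists>r::rat. 0 < r \<and> x - z = of_rat r"
  shows "\<exists>a b :: rat. 0 < a \<and> 0 \<le> b \<and> poly f x = of_rat a \<and> poly (pderiv f) x = of_rat b"
  using assms
proof (induction "degree f" arbitrary: f)
  case 0
  obtain c where "f = [:c:]" using 0(1) degree_eq_zeroE by metis
  then have "f = 1" using 0(3) by simp
  then have "poly f x = of_rat 1 \<and> poly (pderiv f) x = of_rat 0" by simp
  then show ?case by (intro exI[of _ 1] exI[of _ 0]) simp
next
  case (Suc n)
  have "\<not> constant (poly f)" using Suc.hyps(2) by (simp add: constant_degree)
  then obtain z where z: "poly f z = 0" using fundamental_theorem_of_algebra by blast
  obtain r where r: "0 < r" "x - z = of_rat r" using Suc.prems(3)[OF z] by blast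
  obtain g where g: "f = [:-z, 1:] * g" using z by (auto simp: poly_eq_0_iff_dvd elim: dvdE)
  have nz: "g \<noteq> 0" using Suc.prems(1) g by auto
  have "lead_coeff g = 1" using Suc.prems(2) unfolding g lead_coeff_mult by simp
  moreover have "n = degree g" using Suc.hyps(2) nz unfolding g by (simp add: degree_mult_eq del: mult_pCons_left)
  moreover have "\<exists>r::rat. 0 < r \<and> x - w = of_rat r" if "poly g w = 0" for w
    using Suc.prems(3)[of w] that g by simp
  ultimately obtain a b where ab: "0 < a" "0 \<le> b" "poly g x = of_rat a" "poly (pderiv g) x = of_rat b"
    using Suc.hyps(1)[of g] nz by blast
  have "poly f x = (x - z) * poly g x" unfolding g by (simp add: algebra_simps)
  then have 1: "poly f x = of_rat (r * a)" unfolding r ab by (simp add: of_rat_mult)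
  have "poly (pderiv f) x = (x - z) * poly (pderiv g) x + poly g x"
    unfolding g pderiv_mult by (simp add: pderiv_pCons algebra_simps)
  then have 2: "poly (pderiv f) x = of_rat (r * b + a)" unfolding r ab by (simp add: of_rat_mult of_rat_add)
  show ?case
    by (intro exI[of _ "r * a"] exI[of _ "r * b + a"]) (use 1 2 ab r in \<open>auto simp: add_nonneg_pos\<close>)
qed

text \<open>With m = n^2 - 1 the number is m(m + 1), strictly between the consecutive squares m^2
  and (m + 1)^2.\<close>

lemma not_rational_square:
  fixes n :: nat and r :: rat
  assumes n: "2 \<le> n" and r: "r^2 = of_nat (n^2 * (n^2 - 1))"
  shows False
proof -
  have "r \<in> \<int>"
  proof -
    obtain a b where ab: "quotient_of r = (a, b)" by force
    have b: "0 < b" "coprime a b" "r = of_int a / of_int b"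
      using quotient_of_denom_pos[OF ab] quotient_of_coprime[OF ab] quotient_of_div[OF ab] by auto
    have "(of_int a :: rat)^2 = of_nat (n^2 * (n^2 - 1)) * (of_int b)^2"
      using r b by (simp add: field_simps)
    then have "(of_int (a^2) :: rat) = of_int (int (n^2 * (n^2 - 1)) * b^2)" by simp
    then have "a^2 = int (n^2 * (n^2 - 1)) * b^2" by (simp only: of_int_eq_iff)
    then have "b^2 dvd a^2" by simp
    then have "b dvd a" by simp
    then have "b = 1" using b(1,2) coprime_absorb_right[of b a] by simp
    then show ?thesis using b(3) by simp
  qed
  then obtain k where k: "r = of_int k" by (elim Ints_cases)
  have "(of_int (k^2) :: rat) = of_int (int (n^2 * (n^2 - 1)))" using r k by simp
  then have "k^2 = int (n^2 * (n^2 - 1))" by (simp only: of_int_eq_iff)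
  moreover have "int ((nat \<bar>k\<bar>)^2) = k^2" by simp
  ultimately have k2: "(nat \<bar>k\<bar>)^2 = n^2 * (n^2 - 1)" by (simp only: of_nat_eq_iff)
  obtain m where m: "n^2 = Suc m" "1 \<le> m"
  proof -
    have "4 \<le> n^2" using power_mono[OF n, of 2] by simp
    then show thesis using that[of "n^2 - 1"] by simp
  qed
  have "m^2 < (nat \<bar>k\<bar>)^2" "(nat \<bar>k\<bar>)^2 < (Suc m)^2"
    unfolding k2 m(1) using m(2) by (simp_all add: power2_eq_square)
  then have "m < nat \<bar>k\<bar>" "nat \<bar>k\<bar> < Suc m" by (auto dest: power_less_imp_less_base)
  then show False by simp
qed

lemma slice_0_root_below:
  assumes FG: "F * G = continuant l l" and top: "poly (slice 0 F) (level l (l div 2)) \<noteq> 0"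
    and z: "poly (slice 0 F) z = 0"
  shows "\<exists>r::rat. 0 < r \<and> ((of_nat l)^2 - 1) / 4 - z = of_rat r"
proof -
  obtain p where p: "z = level l p" "2 * p + 2 \<le> l" by (rule slice_0_factor_root[OF assms])
  define t where "t = l - 2 * p"
  have t: "l = 2 * p + t" "2 \<le> t" using p(2) by (auto simp: t_def)
  have "((of_nat l)^2 - 1) / 4 - z = (of_nat t ^ 2 - 1) / 4"
    unfolding p(1) level_def t(1) by (simp add: field_simps power2_eq_square)
  also have "\<dots> = of_rat ((of_nat t ^ 2 - 1) / 4)" by (simp add: of_rat_divide of_rat_diff of_rat_power)
  finally have "((of_nat l)^2 - 1) / 4 - z = of_rat ((of_nat t ^ 2 - 1) / 4)" .
  moreover have "(0::rat) < (of_nat t ^ 2 - 1) / 4"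
  proof -
    have "1 < t^2" using power_mono[OF t(2), of 2] by simp
    then have "(of_nat 1 :: rat) < of_nat (t^2)" by (simp only: of_nat_less_iff)
    then show ?thesis by simp
  qed
  ultimately show ?thesis by blast
qed

subsection \<open>Irreducibility in lambda and s\<close>

text \<open>The total degree in (lambda, mu), with s counted twice.\<close>

definition weight_le :: "nat \<Rightarrow> complex poly poly \<Rightarrow> bool" where
  "weight_le w q \<longleftrightarrow> (\<forall>i j. coeff (coeff q i) j \<noteq> 0 \<longrightarrow> i + 2 * j \<le> w)"

lemma weight_continuant: "weight_le k (continuant l k)"
proof (induction k rule: less_induct)
  case (less k)
  show ?case
  proof (cases k)
    case 0
    then show ?thesis by (auto simp: weight_le_def coeff_1 split: if_splits)
  next
    case (Suc m)
    have "i + 2 * j \<le> k" if nz: "coeff (coeff (continuant l k) i) j \<noteq> 0" for i j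
    proof -
      have m: "a + 2 * b \<le> m" if "coeff (coeff (continuant l m) a) b \<noteq> 0" for a b
      proof -
        have "weight_le m (continuant l m)" by (rule less.IH) (use Suc in simp)
        then show ?thesis using that unfolding weight_le_def by blast
      qed
      \<comment> \<open>The factor \<open>level l m\<close> stays in the hypothesis because it
        vanishes at \<open>m = 0\<close>, the one case where \<open>m - 1\<close> truncates.\<close>
      have m1: "a + 2 * b \<le> m - 1 \<and> 0 < m" if "level l m * coeff (coeff (continuant l (m - 1)) a) b \<noteq> 0" for a b
      proof -
        have "0 < m" using that by (cases m) auto
        have "weight_le (m - 1) (continuant l (m - 1))" by (rule less.IH) (use Suc in simp)
        moreover have "coeff (coeff (continuant l (m - 1)) a) b \<noteq> 0" using that by force
        ultimately show ?thesis using \<open>0 < m\<close> unfolding weight_le_def by blast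
      qed
      have e: "coeff (coeff (continuant l k) i) j = - level l m * coeff (coeff (continuant l m) i) j
         + (if i = 0 then 0 else coeff (coeff (continuant l m) (i - 1)) j)
         - (if j = 0 then 0 else level l m * coeff (coeff (continuant l (m - 1)) i) (j - 1))"
        unfolding Suc continuant_Suc by (cases i; cases j) simp_all
      consider "coeff (coeff (continuant l m) i) j \<noteq> 0" | "i \<noteq> 0" "coeff (coeff (continuant l m) (i - 1)) j \<noteq> 0"
        | "j \<noteq> 0" "level l m * coeff (coeff (continuant l (m - 1)) i) (j - 1) \<noteq> 0"
        using nz unfolding e by (fastforce split: if_splits)
      then show ?thesis
        by cases (use m[of i j] m[of "i - 1" j] m1[of i "j - 1"] Suc in auto)
    qed
    then show ?thesis unfolding weight_le_def by blast
  qed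
qed

lemma monic_continuant: "degree (continuant l k) = k \<and> lead_coeff (continuant l k) = 1"
proof (induction k rule: less_induct)
  case (less k)
  show ?case
  proof (cases k)
    case (Suc m)
    have m: "degree (continuant l m) = m" "lead_coeff (continuant l m) = 1" using less.IH[of m] Suc by auto
    then have nz: "continuant l m \<noteq> 0" by auto
    define a where "a = [:[:- level l m:], 1:] * continuant l m"
    have a: "degree a = k" "lead_coeff a = 1"
      unfolding a_def lead_coeff_mult using m nz by (simp_all add: degree_mult_eq Suc del: mult_pCons_left)
    have lt: "degree (smult [:0, level l m:] (continuant l (m - 1))) < k"
      using degree_smult_le[of "[:0, level l m:]" "continuant l (m - 1)"] less.IH[of "m - 1"] Suc by simp
    have eq: "continuant l k = a - smult [:0, level l m:] (continuant l (m - 1))" unfolding Suc a_def by (rule continuant_Suc)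
    have H: "degree (a - b) = k \<and> lead_coeff (a - b) = 1" if "degree b < k" for b
      using that a degree_add_eq_left[of "- b" a] by (simp add: coeff_eq_0)
    show ?thesis unfolding eq by (rule H[OF lt])
  qed simp
qed

text \<open>A leading monomial for the order by weight, ties being broken in favour of the larger
  lambda exponent.\<close>

lemma weight_attained:
  assumes "q \<noteq> 0"
  obtains i j where "coeff (coeff q i) j \<noteq> 0" "weight_le (i + 2 * j) q"
    "\<And>i' j'. coeff (coeff q i') j' \<noteq> 0 \<Longrightarrow> i' + 2 * j' = i + 2 * j \<Longrightarrow> i' \<le> i"
proof -
  let ?S = "{(i, j). coeff (coeff q i) j \<noteq> 0}"
  have "?S \<subseteq> (SIGMA i:{..degree q}. {..degree (coeff q i)})" by (auto intro: le_degree)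
  then have fin: "finite ?S" by (rule finite_subset) simp
  have ne: "?S \<noteq> {}" using assms by (auto simp: poly_eq_iff)
  define w where "w = Max ((\<lambda>(i, j). i + 2 * j) ` ?S)"
  have w: "weight_le w q" unfolding weight_le_def w_def using fin by (auto intro!: Max_ge)
  have "w \<in> (\<lambda>(i, j). i + 2 * j) ` ?S" unfolding w_def using fin ne by (intro Max_in) auto
  then have T: "{i. \<exists>j. coeff (coeff q i) j \<noteq> 0 \<and> i + 2 * j = w} \<noteq> {}" (is "?T \<noteq> {}") by auto
  have "?T \<subseteq> fst ` ?S" by force
  then have fT: "finite ?T" using fin finite_surj by blast
  have "Max ?T \<in> ?T" using fT T by (rule Max_in)
  then obtain j where j: "coeff (coeff q (Max ?T)) j \<noteq> 0" "Max ?T + 2 * j = w" by blast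
  show thesis
    by (rule that[of "Max ?T" j]) (use j w fT in \<open>auto intro!: Max_ge\<close>)
qed

text \<open>Among the monomials of maximal weight, those with the largest lambda exponent multiply without
  cancellation.\<close>

lemma weight_mult:
  assumes F: "F \<noteq> 0" and G: "G \<noteq> 0" and FG: "weight_le w (F * G)"
  obtains a b where "weight_le a F" "weight_le b G" "a + b \<le> w"
proof -
  obtain i1 j1 where 1: "coeff (coeff F i1) j1 \<noteq> 0" "weight_le (i1 + 2 * j1) F"
    "\<And>i' j'. coeff (coeff F i') j' \<noteq> 0 \<Longrightarrow> i' + 2 * j' = i1 + 2 * j1 \<Longrightarrow> i' \<le> i1"
    by (rule weight_attained[OF F]) blast
  obtain i2 j2 where 2: "coeff (coeff G i2) j2 \<noteq> 0" "weight_le (i2 + 2 * j2) G"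
    "\<And>i' j'. coeff (coeff G i') j' \<noteq> 0 \<Longrightarrow> i' + 2 * j' = i2 + 2 * j2 \<Longrightarrow> i' \<le> i2"
    by (rule weight_attained[OF G]) blast
  let ?c = "\<lambda>i j. coeff (coeff F i) j * coeff (coeff G (i1 + i2 - i)) (j1 + j2 - j)"
  have z: "?c i j = 0" if ij: "i \<le> i1 + i2" "j \<le> j1 + j2" "(i, j) \<noteq> (i1, j1)" for i j
  proof (rule ccontr)
    assume "?c i j \<noteq> 0"
    then have nz: "coeff (coeff F i) j \<noteq> 0" "coeff (coeff G (i1 + i2 - i)) (j1 + j2 - j) \<noteq> 0" by auto
    have "i + 2 * j \<le> i1 + 2 * j1" "(i1 + i2 - i) + 2 * (j1 + j2 - j) \<le> i2 + 2 * j2"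
      using 1(2) 2(2) nz unfolding weight_le_def by blast+
    then have e: "i + 2 * j = i1 + 2 * j1" "(i1 + i2 - i) + 2 * (j1 + j2 - j) = i2 + 2 * j2"
      using ij by linarith+
    have "i \<le> i1" "i1 + i2 - i \<le> i2" using 1(3)[OF nz(1) e(1)] 2(3)[OF nz(2) e(2)] by auto
    then have "i = i1" using ij by linarith
    then show False using e ij by simp
  qed
  have "coeff (coeff (F * G) (i1 + i2)) (j1 + j2) = (\<Sum>i\<le>i1 + i2. \<Sum>j\<le>j1 + j2. ?c i j)"
    by (simp add: coeff_mult coeff_sum)
  also have "\<dots> = (\<Sum>i\<le>i1 + i2. if i = i1 then (\<Sum>j\<le>j1 + j2. ?c i1 j) else 0)"
  proof (intro sum.cong refl)
    fix i assume i: "i \<in> {..i1 + i2}"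
    show "(\<Sum>j\<le>j1 + j2. ?c i j) = (if i = i1 then (\<Sum>j\<le>j1 + j2. ?c i1 j) else 0)"
      by (cases "i = i1") (use z i in \<open>auto intro!: sum.neutral simp del: mult_eq_0_iff\<close>)
  qed
  also have "\<dots> = (\<Sum>j\<le>j1 + j2. ?c i1 j)" by simp
  also have "\<dots> = (\<Sum>j\<le>j1 + j2. if j = j1 then ?c i1 j1 else 0)"
  proof (intro sum.cong refl)
    fix j assume "j \<in> {..j1 + j2}"
    then show "?c i1 j = (if j = j1 then ?c i1 j1 else 0)" using z[of i1 j] by simp
  qed
  also have "\<dots> = ?c i1 j1" by simp
  finally have "coeff (coeff (F * G) (i1 + i2)) (j1 + j2) \<noteq> 0" using 1(1) 2(1) by simp
  then have "(i1 + i2) + 2 * (j1 + j2) \<le> w" using FG unfolding weight_le_def by blast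
  then show thesis using that[OF 1(2) 2(2)] by simp
qed

text \<open>Being monic, each factor has weight at least its degree. The degrees already add up to
  \<open>l\<close>, the bound for the sum of the weights, so there is no room for more.\<close>

lemma factor_weight:
  assumes FG: "F * G = continuant l l" and F: "lead_coeff F = 1" and G: "lead_coeff G = 1"
  shows "weight_le (degree F) F"
proof -
  have nz: "F \<noteq> 0" "G \<noteq> 0" using F G by auto
  obtain a b where ab: "weight_le a F" "weight_le b G" "a + b \<le> l"
    by (rule weight_mult[OF nz]) (use FG weight_continuant[of l l] in simp_all)
  have d: "degree F + degree G = l" using degree_mult_eq[OF nz] FG monic_continuant[of l l] by simp
  have "coeff (coeff F (degree F)) 0 \<noteq> 0" "coeff (coeff G (degree G)) 0 \<noteq> 0" using F G by simp_all
  then have "degree F + 2 * 0 \<le> a" "degree G + 2 * 0 \<le> b" using ab(1,2) unfolding weight_le_def by blast+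
  then have "a = degree F" using d ab(3) by simp
  then show ?thesis using ab(1) by simp
qed

text \<open>By the weight bound the sum of the roots of F does not depend on s, so the shift defect of F
  is determined by its leading coefficient. At x = (l^2 - 1)/4, where the coefficient of g in the
  shift defect vanishes and which lies above all roots of f, this contradicts positivity or, in the
  exceptional case, irrationality.\<close>

lemma factor_degree_0:
  assumes l: "2 \<le> l" and FG: "F * G = continuant l l" and F: "lead_coeff F = 1" and G: "lead_coeff G = 1"
    and top: "poly (slice 0 F) (level l (l div 2)) \<noteq> 0"
  shows "degree F = 0"
proof (rule ccontr)
  assume "degree F \<noteq> 0"
  define d where "d = degree F"
  have d: "1 \<le> d" using \<open>degree F \<noteq> 0\<close> by (simp add: d_def)
  define f where "f = slice 0 F"
  define g where "g = slice 1 F"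
  have w: "i + 2 * j \<le> d" if "coeff (coeff F i) j \<noteq> 0" for i j
    using factor_weight[OF FG F G] that unfolding weight_le_def d_def by blast
  have fc: "coeff f d = 1" using F unfolding f_def coeff_slice d_def by simp
  have "degree f \<le> d" unfolding f_def by (rule degree_le) (simp add: coeff_slice coeff_eq_0 d_def)
  moreover have "d \<le> degree f" using fc by (intro le_degree) simp
  ultimately have f: "degree f = d" "lead_coeff f = 1" using fc by auto
  \<comment> \<open>A term linear in s has weight i + 2, so \<open>g\<close> has no term of degree d
    - 1: the sum of the roots has no first-order part.\<close>
  have g0: "coeff g i = 0" if "d < i + 2" for i
    using w[of i 1] that unfolding g_def coeff_slice by fastforce
  have g1: "coeff g (d - 1) = 0" using g0[of "d - 1"] d by simp
  have "degree g \<le> d - 1" by (rule degree_le) (use g0 in auto)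
  then have g2: "degree g < d" using d by simp
  define N where "N = (of_nat l ^ 2 - 1 :: rat)"
  have N: "0 \<le> N"
  proof -
    have "(of_nat 1 :: rat) \<le> of_nat (l^2)" using l by (simp only: of_nat_le_iff) simp
    then show ?thesis by (simp add: N_def)
  qed
  have cN: "(of_nat l ^ 2 - 1 :: complex) = of_rat N" by (simp add: N_def of_rat_diff of_rat_power)
  define x where "x = (of_nat l ^ 2 - 1 :: complex) / 4"
  have fnz: "f \<noteq> 0" using f by auto
  have roots: "\<exists>r::rat. 0 < r \<and> x - z = of_rat r" if "poly f z = 0" for z
    using slice_0_root_below[OF FG top] that unfolding f_def x_def by blast
  obtain a b where ab: "0 < a" "0 \<le> b" "poly f x = of_rat a" "poly (pderiv f) x = of_rat b"
    using real_rooted_values[OF fnz f(2) roots] by blast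
  have rx: "poly (shift_defect l f g) x = - of_rat (N / 2 * b)"
  proof -
    have x4: "of_rat N - 4 * x = 0" "of_rat N - 2 * x = of_rat N / 2" by (simp_all add: x_def cN)
    have "poly (shift_defect l f g) x = - (of_rat N / 2) * of_rat b"
      unfolding poly_shift_defect ab(4) cN x4 by simp
    then show ?thesis by (simp add: of_rat_mult of_rat_divide)
  qed
  have fx: "poly (smult (2 * of_nat d) f) x = of_rat (2 * of_nat d * a)"
    by (simp add: ab of_rat_mult)
  have pos: "0 < 2 * of_nat d * a" using ab(1) d by simp
  from slice_dvd_shift_defect[OF FG top, folded f_def g_def] show False
  proof
    assume "f dvd shift_defect l f g"
    then have "shift_defect l f g + 0 = smult (2 * of_nat d) f"
      by (intro shift_defect_eq) (use f d g1 g2 in auto)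
    then have "(of_rat (- (N / 2 * b)) :: complex) = of_rat (2 * of_nat d * a)"
      using rx fx by (simp add: of_rat_minus)
    then have "- (N / 2 * b) = 2 * of_nat d * a" by (simp only: of_rat_eq_iff)
    moreover have "0 \<le> N / 2 * b" using N ab(2) by simp
    ultimately show False using pos by linarith
  next
    assume "\<exists>p h \<delta>. 1 \<le> p \<and> l = 2 * p + 2 \<and> f = [:- level l p, 1:] * h \<and>
      \<delta>^2 = level l p * (level l p + 1) \<and> f dvd shift_defect l f g + smult (3 * \<delta>) h"
    then obtain p h \<delta> where p: "1 \<le> p" "l = 2 * p + 2" and h: "f = [:- level l p, 1:] * h"
      and \<delta>: "\<delta>^2 = level l p * (level l p + 1)" and dv: "f dvd shift_defect l f g + smult (3 * \<delta>) h" by blast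
    have hnz: "h \<noteq> 0" using h fnz by auto
    have "lead_coeff h = 1" using f(2) unfolding h lead_coeff_mult by simp
    have dh: "d = Suc (degree h)"
      unfolding f(1)[symmetric] h using hnz by (simp add: degree_mult_eq del: mult_pCons_left)
    have rh: "\<exists>r::rat. 0 < r \<and> x - z = of_rat r" if "poly h z = 0" for z
      using roots[of z] that h by simp
    obtain c e where c: "0 < c" "0 \<le> e" "poly h x = of_rat c" "poly (pderiv h) x = of_rat e"
      using real_rooted_values[OF hnz \<open>lead_coeff h = 1\<close> rh] by blast
    have "shift_defect l f g + smult (3 * \<delta>) h = smult (2 * of_nat d) f"
      by (rule shift_defect_eq[OF f(2,1) d g2 g1 _ dv]) (use dh degree_smult_le[of "3 * \<delta>" h] in simp)
    then have "poly (shift_defect l f g + smult (3 * \<delta>) h) x = of_rat (2 * of_nat d * a)" using fx by simp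
    then have "3 * \<delta> * of_rat c = of_rat (2 * of_nat d * a) + of_rat (N / 2 * b)"
      unfolding poly_add rx poly_smult c(3) by (simp add: algebra_simps)
    then have e: "3 * of_rat c * \<delta> = of_rat (2 * of_nat d * a + N / 2 * b)" by (simp only: of_rat_add mult_ac)
    define r where "r = (2 * of_nat d * a + N / 2 * b) / (3 * c)"
    have "(3 * of_rat c :: complex) \<noteq> 0" using c(1) by simp
    then have "\<delta> = of_rat (2 * of_nat d * a + N / 2 * b) / (3 * of_rat c)"
      using e by (metis nonzero_mult_div_cancel_left)
    then have dr: "\<delta> = of_rat r" unfolding r_def by (simp only: of_rat_divide of_rat_mult of_rat_numeral_eq)
    \<comment> \<open>The level is p(p + 2), so with n = p + 1 the two factors are n^2 - 1 and
      n^2.\<close>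
    have zv: "level l p * (level l p + 1) = of_nat ((p + 1)^2 * ((p + 1)^2 - 1))"
      unfolding level_def p(2) by (simp add: algebra_simps power2_eq_square)
    have "(of_rat (r^2) :: complex) = of_rat (of_nat ((p + 1)^2 * ((p + 1)^2 - 1)))"
      using \<delta> unfolding dr zv of_rat_power of_rat_of_nat_eq .
    then have "r^2 = of_nat ((p + 1)^2 * ((p + 1)^2 - 1))" by (simp only: of_rat_eq_iff)
    then show False by (rule not_rational_square[rotated]) (use p in simp)
  qed
qed

text \<open>Two factors through the top point would make the curve singular there, whereas its
  linear term is nonzero: in the s direction for odd \<open>l\<close>, in the lambda direction for
  even \<open>l\<close>.\<close>

lemma slice_0_factors_middle:
  assumes l: "2 \<le> l" and FG: "F * G = continuant l l"
  shows "poly (slice 0 F) (level l (l div 2)) \<noteq> 0 \<or> poly (slice 0 G) (level l (l div 2)) \<noteq> 0"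
proof (rule ccontr)
  let ?p = "l div 2"
  assume "\<not> ?thesis"
  then have "poly (slice 0 F) (level l ?p) = 0" "poly (slice 0 G) (level l ?p) = 0" by auto
  then have 0: "coeff (line (continuant l l) (level l ?p) u) 1 = 0" for u
    unfolding FG[symmetric] poly_mult coeff_mult_low(2) line_coeffs(1) by simp
  show False
  proof (cases "even l")
    case True
    then have l2: "l = ?p + ?p" by auto
    have ne: "level l ?p - level l i \<noteq> 0" if "i \<noteq> ?p" for i
      using level_diff_nonzero[of i ?p ?p] that l2 by simp
    have "(\<Prod>i<?p. level l ?p - level l i) * (\<Prod>i=?p+1..<l. level l ?p - level l i) \<noteq> 0"
      using ne by (auto simp: prod_zero_iff)
    moreover have "?p + 1 \<le> l" using l by simp
    ultimately show False using line_continuant_coeff_1_top[OF l2, of l 1] 0[of 1] 0[of 0] by simp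
  next
    case False
    then have l2: "l = ?p + (?p + 1)" by presburger
    have ne: "level l ?p - level l i \<noteq> 0" if "i \<noteq> ?p" "i \<noteq> ?p + 1" for i
      using level_diff_nonzero[of i ?p "?p + 1"] that l2 by simp
    have "level l ?p \<noteq> 0" using l by (intro level_nonzero) auto
    then have "(\<Prod>i<?p. level l ?p - level l i) * (- level l ?p) * (\<Prod>i=?p+2..<l. level l ?p - level l i) \<noteq> 0"
      using ne by (auto simp: prod_zero_iff)
    moreover have "?p + 2 \<le> l" using l False by presburger
    ultimately show False using line_continuant_coeff_1_middle[OF l2, of l 0] 0[of 0] by simp
  qed
qed

lemma continuant_irreducible:
  assumes FG: "F * G = continuant l l" and F: "lead_coeff F = 1" and G: "lead_coeff G = 1"
  shows "degree F = 0 \<or> degree G = 0"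
proof (cases "2 \<le> l")
  case True
  have GF: "G * F = continuant l l" using FG by (simp add: mult.commute)
  show ?thesis
    using slice_0_factors_middle[OF True FG] factor_degree_0[OF True FG F G] factor_degree_0[OF True GF G F] by metis
next
  case False
  have "F \<noteq> 0" "G \<noteq> 0" using F G by auto
  then have "degree F + degree G = l" using degree_mult_eq[of F G] FG monic_continuant[of l l] by simp
  then show ?thesis using False by linarith
qed

subsection \<open>Irreducibility in lambda and mu\<close>

lemma eval2_altdef: "eval2 p x y = poly (poly p [:x:]) y"
  by (induction p) (simp_all add: eval2_def map_poly_pCons)

lemma eval2_mult: "eval2 (p * q) x y = eval2 p x y * eval2 q x y"
  by (simp add: eval2_altdef)

lemma eval2_1 [simp]: "eval2 1 x y = 1"
  by (simp add: eval2_altdef)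

lemma eval2_y_0: "eval2 q x 0 = poly (slice 0 q) x"
  by (induction q) (simp_all add: eval2_altdef slice_pCons poly_0_coeff_0)

section \<open>Substitution in the second variable\<close>

definition subst_y :: "complex poly \<Rightarrow> complex poly poly \<Rightarrow> complex poly poly" where
  "subst_y g q = map_poly (\<lambda>c. pcompose c g) q"

lemma coeff_subst_y: "coeff (subst_y g q) i = pcompose (coeff q i) g"
  by (simp add: subst_y_def coeff_map_poly)

lemma subst_y_mult: "subst_y g (p * q) = subst_y g p * subst_y g q"
  by (rule poly_eqI) (simp add: coeff_subst_y coeff_mult pcompose_sum pcompose_mult)

lemma eval2_subst_y: "eval2 (subst_y g q) x y = eval2 q x (poly g y)"
  by (induction q) (simp_all add: eval2_altdef subst_y_def map_poly_pCons poly_pcompose)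

lemma subst_y_subst_y: "subst_y g (subst_y h q) = subst_y (pcompose h g) q"
  by (rule poly_eqI) (simp add: coeff_subst_y pcompose_assoc)

lemma subst_y_monic:
  assumes "lead_coeff q = 1"
  shows "degree (subst_y g q) = degree q" "lead_coeff (subst_y g q) = 1"
proof -
  have "degree (subst_y g q) \<le> degree q" by (rule degree_le) (simp add: coeff_subst_y coeff_eq_0)
  moreover have "degree q \<le> degree (subst_y g q)" by (rule le_degree) (simp add: coeff_subst_y assms pcompose_1)
  ultimately show "degree (subst_y g q) = degree q" by simp
  then show "lead_coeff (subst_y g q) = 1" by (simp add: coeff_subst_y assms pcompose_1)
qed

lemma monic_dvd_same_degree:
  fixes A B :: "complex poly poly"
  assumes "A dvd B" "lead_coeff A = 1" "lead_coeff B = 1" "degree A = degree B"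
  shows "A = B"
proof -
  obtain C where C: "B = A * C" using assms(1) by (elim dvdE)
  have nz: "A \<noteq> 0" "C \<noteq> 0" using C assms(2,3) by auto
  have "degree C = 0" using degree_mult_eq[OF nz] C assms(4) by simp
  moreover have "lead_coeff C = 1" using lead_coeff_mult[of A C] C assms(2,3) by simp
  ultimately have "C = 1" using degree_eq_zeroE by (metis lead_coeff_pCons(2) one_pCons pCons_0_0 coeff_pCons_0)
  then show ?thesis using C by simp
qed

lemma even_poly:
  fixes c :: "complex poly"
  assumes "pcompose c [:0, -1:] = c"
  shows "\<exists>e. c = pcompose e [:0, 0, 1:]"
  using assms
proof (induction "degree c" arbitrary: c rule: less_induct)
  case less
  show ?case
  proof (cases "degree c = 0")
    case True
    then obtain a where "c = [:a:]" by (rule degree_eq_zeroE)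
    then show ?thesis by (intro exI[of _ "[:a:]"]) simp
  next
    case False
    obtain a d where c: "c = pCons a d" by (rule pCons_cases)
    have "pCons 0 (- pcompose d [:0, -1:]) = pCons 0 d"
      using less.prems unfolding c by (simp add: pcompose_pCons)
    then have d: "- pcompose d [:0, -1:] = d" by simp
    obtain b e where de: "d = pCons b e" by (rule pCons_cases)
    have "coeff (- pcompose d [:0, -1:]) 0 = coeff d 0" using d by simp
    then have b: "b = 0" unfolding de by (simp add: pcompose_pCons)
    have "pCons 0 (pcompose e [:0, -1:]) = pCons 0 e"
      using d unfolding de b by (simp add: pcompose_pCons)
    then have e: "pcompose e [:0, -1:] = e" by simp
    have "e = 0 \<or> degree e < degree c" unfolding c de by (auto simp: degree_pCons_eq_if)
    then have "degree e < degree c" using False by auto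
    from less.hyps[OF this e] obtain e' where e': "e = pcompose e' [:0, 0, 1:]" by blast
    have "c = pcompose (pCons a e') [:0, 0, 1:]"
      unfolding c de b e' by (simp add: pcompose_pCons)
    then show ?thesis by blast
  qed
qed

lemma pcompose_square_eq_0:
  fixes e :: "complex poly"
  shows "pcompose e [:0, 0, 1:] = 0 \<longleftrightarrow> e = 0"
  by (simp add: pcompose_eq_0_iff)

lemma subst_y_square_inj: "subst_y [:0, 0, 1:] p = subst_y [:0, 0, 1:] q \<Longrightarrow> p = q"
proof -
  assume eq: "subst_y [:0, 0, 1:] p = subst_y [:0, 0, 1:] q"
  have "coeff p i = coeff q i" for i
  proof -
    have "pcompose (coeff p i - coeff q i) [:0, 0, 1:] = 0"
      using arg_cong[OF eq, of "\<lambda>r. coeff r i"] by (simp add: coeff_subst_y pcompose_diff)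
    then show ?thesis by (simp only: pcompose_square_eq_0) simp
  qed
  then show "p = q" by (rule poly_eqI)
qed

lemma subst_y_even:
  assumes "subst_y [:0, -1:] q = q"
  shows "\<exists>r. q = subst_y [:0, 0, 1:] r"
proof -
  have "\<exists>e. coeff q i = pcompose e [:0, 0, 1:]" for i
    using even_poly[of "coeff q i"] arg_cong[OF assms, of "\<lambda>r. coeff r i"] by (simp add: coeff_subst_y)
  then obtain e where e: "\<And>i. coeff q i = pcompose (e i) [:0, 0, 1:]" by metis
  \<comment> \<open>As \<open>e\<close> is chosen coefficient by coefficient, its finite support
    needs an argument: substituting y^2 is injective, so a zero coefficient of \<open>q\<close>
    forces \<open>e i = 0\<close>.\<close>
  have "e i = 0" if "degree q < i" for i
    using e[of i] that by (simp add: coeff_eq_0 pcompose_square_eq_0)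
  then have "\<forall>\<^sub>\<infinity>i. e i = 0" unfolding MOST_nat by blast
  then have "coeff (Abs_poly e) = e" by (rule coeff_Abs_poly_If_le[THEN fun_cong] | simp add: Abs_poly_inverse)
  then have "q = subst_y [:0, 0, 1:] (Abs_poly e)" by (intro poly_eqI) (simp add: coeff_subst_y e)
  then show ?thesis ..
qed

section \<open>The prime factor through a point\<close>

lemma monic_factor_normalize:
  fixes A B F :: "complex poly poly"
  assumes "A * B = F" "lead_coeff F = 1"
  obtains a b where "lead_coeff (smult a A) = 1" "lead_coeff (smult b B) = 1"
    "smult a A * smult b B = F" "a * b = 1"
proof -
  have ab: "lead_coeff B * lead_coeff A = 1" using assms lead_coeff_mult[of A B] by (simp add: mult.commute)
  have nz: "A \<noteq> 0" "B \<noteq> 0" using assms by auto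
  have "smult (lead_coeff B) A * smult (lead_coeff A) B = F"
    using assms ab by (simp add: mult.commute)
  then show thesis using that[of "lead_coeff B" "lead_coeff A"] ab nz by (simp add: mult.commute)
qed

lemma monic_degree_0:
  fixes A :: "complex poly poly"
  assumes "lead_coeff A = 1" "degree A = 0"
  shows "A = 1"
proof -
  obtain a where "A = [:a:]" using assms(2) by (rule degree_eq_zeroE)
  then show ?thesis using assms(1) by (simp add: one_pCons)
qed

text \<open>After scaling both factors to be monic, one of them passes through the point; by
  minimality it has full degree, so the other is 1. Irreducible elements are prime here because
  C[y][x] is factorial.\<close>

lemma minimal_vanishing_divisor_prime:
  assumes F: "lead_coeff F = 1" "eval2 F x y = 0"
    and min: "\<And>A. lead_coeff A = 1 \<Longrightarrow> A dvd F \<Longrightarrow> eval2 A x y = 0 \<Longrightarrow> degree F \<le> degree A"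
  shows "prime_elem F"
proof (rule irreducible_imp_prime_elem, rule irreducibleI)
  show F0: "F \<noteq> 0" using F(1) by auto
  show "\<not> is_unit F"
  proof
    assume "is_unit F"
    then have "degree F = 0" by (metis is_unit_polyE degree_pCons_0)
    then have "F = 1" by (rule monic_degree_0[OF F(1)])
    then show False using F(2) by simp
  qed
  fix A B assume AB: "F = A * B"
  obtain a b where ab: "lead_coeff (smult a A) = 1" "lead_coeff (smult b B) = 1"
    "smult a A * smult b B = F" "a * b = 1"
    by (rule monic_factor_normalize[OF AB[symmetric] F(1)])
  have unit: "is_unit D" if D: "C * smult d D = F" "lead_coeff (smult d D) = 1" "lead_coeff C = 1" "eval2 C x y = 0" for C D d
  proof -
    have nz: "C \<noteq> 0" "smult d D \<noteq> 0" using D by auto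
    have "degree F \<le> degree C" by (rule min[OF D(3) dvdI[OF D(1)[symmetric]] D(4)])
    then have "degree (smult d D) = 0" using degree_mult_eq[OF nz] unfolding D(1) by linarith
    then have "smult d D = 1" by (rule monic_degree_0[OF D(2)])
    then have "[:d:] * D = 1" by simp
    then show ?thesis by (metis dvdI mult.commute)
  qed
  have "eval2 (smult a A) x y * eval2 (smult b B) x y = 0" using F(2) ab(3) eval2_mult by metis
  then consider "eval2 (smult a A) x y = 0" | "eval2 (smult b B) x y = 0" by auto
  then show "is_unit A \<or> is_unit B"
  proof cases
    case 1
    then show ?thesis using unit[OF ab(3,2,1)] by blast
  next
    case 2
    have "smult b B * smult a A = F" using ab(3) by (simp only: mult.commute)
    from unit[OF this ab(1,2) 2] show ?thesis by blast
  qed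
qed

definition spectral_poly :: "nat \<Rightarrow> complex poly poly" where
  "spectral_poly l = subst_y [:0, 0, 1:] (continuant l l)"

text \<open>On mu = 0 the polynomial is the product of the lambda - \<open>level l i\<close> for i <
  l, where only i = 0 gives the root 0. Two factors through the origin would make this root
  double.\<close>

lemma continuant_simple_root:
  assumes l: "1 \<le> l" and eq: "spectral_poly l = A * (B * C)"
  shows "eval2 A 0 0 \<noteq> 0 \<or> eval2 B 0 0 \<noteq> 0"
proof (rule ccontr)
  assume "\<not> ?thesis"
  then have "poly (slice 0 A) 0 = 0" "poly (slice 0 B) 0 = 0" by (auto simp: eval2_y_0)
  then obtain a b where ab: "slice 0 A = [:0, 1:] * a" "slice 0 B = [:0, 1:] * b"
    by (auto simp: poly_eq_0_iff_dvd elim!: dvdE)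
  define c where "c = slice 0 C"
  define r where "r = (\<Prod>i=1..<l. [:- level l i, 1:])"
  have "poly ([:0, 1:] * ([:0, 1:] * (a * b * c))) x = poly ([:0, 1:] * r) x" for x
  proof -
    have "poly ([:0, 1:] * ([:0, 1:] * (a * b * c))) x = eval2 (A * (B * C)) x 0"
      unfolding eval2_y_0 slice_0_mult ab c_def[symmetric] by (simp add: algebra_simps)
    also have "\<dots> = (\<Prod>i<l. x - level l i)"
      unfolding eq[symmetric] spectral_poly_def eval2_subst_y using eval2_y_0[of "continuant l l" x] by (simp add: poly_slice_0_continuant)
    also have "{..<l} = insert 0 {1..<l}" using l by auto
    also have "(\<Prod>i\<in>insert 0 {1..<l}. x - level l i) = poly ([:0, 1:] * r) x"
      by (simp add: r_def poly_prod)
    finally show ?thesis .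
  qed
  then have "poly ([:0, 1:] * ([:0, 1:] * (a * b * c))) = poly ([:0, 1:] * r)" by (rule ext)
  then have "[:0, 1:] * ([:0, 1:] * (a * b * c)) = [:0, 1:] * r" by (simp only: poly_eq_poly_eq_iff)
  then have "[:0, 1:] * (a * b * c) = r" by (subst (asm) mult_left_cancel) auto
  then have "poly r 0 = 0" by (metis mult_zero_left poly_mult poly_pCons mult_zero_left add_0)
  then show False using level_nonzero by (auto simp: r_def poly_prod)
qed

text \<open>The origin is a smooth point of the curve, so the factor through it is invariant under the
  symmetry mu to -mu and hence a polynomial in the square of mu.\<close>

lemma spectral_poly_prime:
  assumes l: "1 \<le> l"
  shows "prime_elem (spectral_poly l)"
proof -
  let ?p = "spectral_poly l" and ?\<sigma> = "subst_y [:0, -1:]"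
  have c: "lead_coeff (continuant l l) = 1" "degree (continuant l l) = l" using monic_continuant by blast+
  have p: "lead_coeff ?p = 1" "degree ?p = l" using subst_y_monic[OF c(1)] c(2) unfolding spectral_poly_def by auto
  have sp: "?\<sigma> ?p = ?p" unfolding spectral_poly_def subst_y_subst_y by (simp add: pcompose_pCons)
  define P where "P A \<longleftrightarrow> lead_coeff A = 1 \<and> A dvd ?p \<and> eval2 A 0 0 = 0" for A
  have "eval2 ?p 0 0 = 0"
    unfolding spectral_poly_def eval2_subst_y using l eval2_y_0[of "continuant l l" 0]
    by (auto simp: poly_slice_0_continuant intro!: bexI[of _ 0])
  then have "P ?p" using p by (simp add: P_def)
  then obtain F where F: "P F" "\<And>A. P A \<Longrightarrow> degree F \<le> degree A"
    using ex_has_least_nat[of P ?p degree] by blast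
  then have F1: "lead_coeff F = 1" "F dvd ?p" "eval2 F 0 0 = 0" by (auto simp: P_def)
  have prime: "prime_elem A" if "P A" "degree A = degree F" for A
    by (rule minimal_vanishing_divisor_prime[of A 0 0])
      (use that F(2) dvd_trans in \<open>fastforce simp: P_def\<close>)+
  obtain G where G: "?p = F * G" using F1(2) by (elim dvdE)
  have sF: "lead_coeff (?\<sigma> F) = 1" "degree (?\<sigma> F) = degree F" using subst_y_monic[OF F1(1)] by auto
  have "?p = ?\<sigma> F * ?\<sigma> G" using sp G subst_y_mult by metis
  then have PsF: "P (?\<sigma> F)" using sF F1(3) by (simp add: P_def eval2_subst_y)
  have "?\<sigma> F dvd F * G" using PsF G by (simp add: P_def)
  then have "?\<sigma> F dvd F \<or> ?\<sigma> F dvd G" using prime[OF PsF sF(2)] by (rule prime_elem_dvd_multD[rotated])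
  moreover have "\<not> ?\<sigma> F dvd G"
  proof
    assume "?\<sigma> F dvd G"
    then obtain C where "?p = F * (?\<sigma> F * C)" using G by (auto elim: dvdE)
    from continuant_simple_root[OF l this] show False using F1(3) PsF by (simp add: P_def)
  qed
  ultimately have FF: "?\<sigma> F = F" using monic_dvd_same_degree[OF _ sF(1) F1(1) sF(2)] by blast
  have F0: "F \<noteq> 0" using F1(1) by auto
  have GG: "?\<sigma> G = G"
  proof -
    have "F * ?\<sigma> G = F * G" using sp unfolding G subst_y_mult FF .
    then show ?thesis using F0 by simp
  qed
  obtain F' G' where F': "F = subst_y [:0, 0, 1:] F'" and G': "G = subst_y [:0, 0, 1:] G'"
    using subst_y_even[OF FF] subst_y_even[OF GG] by blast
  have "subst_y [:0, 0, 1:] (continuant l l) = subst_y [:0, 0, 1:] (F' * G')"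
    using G F' G' subst_y_mult spectral_poly_def by metis
  then have FG': "F' * G' = continuant l l" using subst_y_square_inj by metis
  obtain a b where ab: "lead_coeff (smult a F') = 1" "lead_coeff (smult b G') = 1"
    "smult a F' * smult b G' = continuant l l" "a * b = 1"
    by (rule monic_factor_normalize[OF FG' c(1)])
  have nz: "a \<noteq> 0" "b \<noteq> 0" using ab(4) by auto
  have dF: "degree F \<noteq> 0" using monic_degree_0[OF F1(1)] F1(3) by (metis eval2_1 zero_neq_one)
  have le: "degree (subst_y g q) \<le> degree q" for g q
    by (rule degree_le) (simp add: coeff_subst_y coeff_eq_0)
  have "degree (smult a F') \<noteq> 0" using dF nz le[of "[:0,0,1:]" F'] F' by auto
  then have "degree (smult b G') = 0" using continuant_irreducible[OF ab(3,1,2)] by metis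
  then have "degree G = 0" using nz le[of "[:0,0,1:]" G'] G' by auto
  moreover have "lead_coeff G = 1" using lead_coeff_mult[of F G] G p(1) F1(1) by simp
  ultimately have "G = 1" by (rule monic_degree_0[rotated])
  then show ?thesis using G prime[OF F(1) refl] by simp
qed

subsection \<open>Prime polynomials and irreducible sets\<close>

text \<open>By pseudo-division, an element of least degree in the ideal generated by p and g divides
  both of them up to factors from the coefficient ring.\<close>

lemma prime_bezout:
  fixes p g :: "complex poly poly"
  assumes p: "prime_elem p" "degree p \<noteq> 0" and g: "\<not> p dvd g"
  obtains a b c where "c \<noteq> 0" "a * p + b * g = [:c:]"
proof -
  define P where "P r \<longleftrightarrow> r \<noteq> 0 \<and> (\<exists>a b. r = a * p + b * g)" for r
  have p0: "p \<noteq> 0" using p(2) by auto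
  have "p = 1 * p + 0 * g" "g = 0 * p + 1 * g" by simp_all
  then have in_ideal: "\<exists>a b. p = a * p + b * g" "\<exists>a b. g = a * p + b * g" by blast+
  then have "P p" using p0 by (simp add: P_def)
  then obtain r where r: "P r" "\<And>s. P s \<Longrightarrow> degree r \<le> degree s"
    using ex_has_least_nat[of P p degree] by blast
  then obtain a b where ab: "r \<noteq> 0" "r = a * p + b * g" by (auto simp: P_def)
  have div: "\<exists>c q. c \<noteq> 0 \<and> smult c f = r * q" if f: "\<exists>a b. f = a * p + b * g" for f
  proof -
    obtain c q where cq: "c \<noteq> 0" "smult c f = r * q + pseudo_mod f r" using pseudo_mod(1)[OF ab(1)] by blast
    obtain a' b' where f': "f = a' * p + b' * g" using f by blast
    have "pseudo_mod f r = smult c f - r * q" using cq(2) by simp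
    also have "\<dots> = ([:c:] * a' - a * q) * p + ([:c:] * b' - b * q) * g"
    proof -
      have "smult c f = [:c:] * f" by simp
      then show ?thesis by (simp only: f' ab(2)) (simp only: ring_distribs mult_ac add_diff_eq diff_diff_add add_ac)
    qed
    finally have "pseudo_mod f r = 0 \<or> P (pseudo_mod f r)" unfolding P_def by blast
    then have "pseudo_mod f r = 0" using pseudo_mod(2)[OF ab(1), of f] r(2)[of "pseudo_mod f r"] by auto
    then show ?thesis using cq by auto
  qed
  have const_ndvd: "\<not> p dvd [:c:]" if "c \<noteq> 0" for c
  proof
    assume "p dvd [:c:]"
    then have "degree p \<le> degree [:c:]" by (rule dvd_imp_degree_le) (use that in simp)
    then show False using p(2) by simp
  qed
  obtain c q where c: "c \<noteq> 0" "smult c p = r * q" using div[OF in_ideal(1)] by blast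
  obtain c' q' where c': "c' \<noteq> 0" "smult c' g = r * q'" using div[OF in_ideal(2)] by blast
  have "p dvd r * q" unfolding c(2)[symmetric] by (rule dvd_smult) simp
  then have "p dvd r \<or> p dvd q" using prime_elem_dvd_multD[OF p(1)] by simp
  \<comment> \<open>Otherwise \<open>p\<close> divides a coefficient-ring multiple of
    \<open>g\<close>, hence \<open>g\<close>, being prime of positive degree.\<close>
  moreover have "\<not> p dvd r"
  proof
    assume "p dvd r"
    then have "p dvd [:c':] * g" using c'(2) by simp
    then have "p dvd [:c':] \<or> p dvd g" using prime_elem_dvd_multD[OF p(1)] by simp
    then show False using g const_ndvd[OF c'(1)] by simp
  qed
  ultimately obtain t where t: "q = p * t" by (auto elim: dvdE)
  have "p * (r * t) = p * [:c:]" using c(2) unfolding t by (simp add: mult_ac)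
  then have "r * t = [:c:]" using p0 by (simp only: mult_cancel_left) simp
  moreover have "[:c:] \<noteq> 0" using c(1) by simp
  ultimately have "degree r = 0" by (metis degree_mult_eq_0 degree_pCons_0 mult_zero_left mult_zero_right add_is_0 degree_mult_eq)
  then obtain e where "r = [:e:]" by (rule degree_eq_zeroE)
  then show thesis using that[of e a b] ab by auto
qed

lemma eval2_add: "eval2 (p + q) x y = eval2 p x y + eval2 q x y"
  by (simp add: eval2_altdef)

text \<open>For a polynomial that is monic in x every fibre of its zero set over y is nonempty;
  this is what makes a nonzero element of C[y] in the ideal impossible.\<close>

lemma vanishing_imp_dvd:
  assumes p: "prime_elem p" "lead_coeff p = 1" "degree p \<noteq> 0"
    and g: "\<And>x y. eval2 p x y = 0 \<Longrightarrow> eval2 g x y = 0"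
  shows "p dvd g"
proof (rule ccontr)
  assume "\<not> p dvd g"
  then obtain a b c where c: "c \<noteq> 0" "a * p + b * g = [:c:]" using prime_bezout[OF p(1,3)] by metis
  have "poly c y = 0" for y
  proof -
    let ?q = "map_poly (\<lambda>c. poly c y) p"
    have "coeff ?q (degree p) = 1" using p(2) by (simp add: coeff_map_poly)
    then have "degree p \<le> degree ?q" by (intro le_degree) simp
    then have "\<not> constant (poly ?q)" using p(3) by (simp add: constant_degree)
    then obtain x where x: "eval2 p x y = 0" unfolding eval2_def using fundamental_theorem_of_algebra by blast
    have "eval2 (a * p + b * g) x y = 0" using x g[OF x] by (simp add: eval2_add eval2_mult)
    then show ?thesis unfolding c(2) by (simp add: eval2_altdef)
  qed
  then show False using c(1) poly_all_0_iff_0 by blast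
qed

lemma irreducible_zero_set:
  assumes p: "prime_elem p" "lead_coeff p = 1" "degree p \<noteq> 0"
  shows "irreducible_algebraic_set (zero_set {p})"
  unfolding irreducible_algebraic_set_def
proof (intro conjI allI impI)
  show "algebraic_set (zero_set {p})" unfolding algebraic_set_def by blast
  show "zero_set {p} \<noteq> {}"
  proof
    assume "zero_set {p} = {}"
    then have "eval2 p x y \<noteq> 0" for x y by (auto simp: zero_set_def)
    \<comment> \<open>Over an empty zero set the constant 1 satisfies the vanishing hypothesis
      vacuously.\<close>
    then have "p dvd 1" by (intro vanishing_imp_dvd[OF p]) simp
    then show False using p(1) by (simp add: prime_elem_def)
  qed
  fix A B assume "algebraic_set A" "algebraic_set B" and V: "zero_set {p} = A \<union> B"
  then obtain S T where A: "A = zero_set S" and B: "B = zero_set T" by (auto simp: algebraic_set_def)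
  show "zero_set {p} = A \<or> zero_set {p} = B"
  proof (rule ccontr)
    assume "\<not> ?thesis"
    then obtain v w where vw: "v \<in> zero_set {p}" "v \<notin> A" "w \<in> zero_set {p}" "w \<notin> B"
      using V by auto
    then obtain g h where g: "g \<in> S" "eval2 g (fst v) (snd v) \<noteq> 0"
      and h: "h \<in> T" "eval2 h (fst w) (snd w) \<noteq> 0"
      unfolding A B zero_set_def by (auto simp: case_prod_beta)
    have "p dvd g * h"
    proof (rule vanishing_imp_dvd[OF p])
      fix x y assume "eval2 p x y = 0"
      then have "(x, y) \<in> A \<union> B" unfolding V[symmetric] by (simp add: zero_set_def)
      then show "eval2 (g * h) x y = 0" using g(1) h(1) unfolding A B zero_set_def by (auto simp: eval2_mult)
    qed
    then have "p dvd g \<or> p dvd h" using prime_elem_dvd_multD[OF p(1)] by simp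
    moreover have "eval2 p (fst v) (snd v) = 0" "eval2 p (fst w) (snd w) = 0"
      using vw by (auto simp: zero_set_def case_prod_beta)
    ultimately show False using g(2) h(2) by (auto simp: eval2_mult elim!: dvdE)
  qed
qed

subsection \<open>The determinant\<close>

text \<open>Expanding along the last row, and the remaining minor along its last column, leads back
  to leading principal minors of the same entries. This is the recursion of the continuants, where
  the size grows while \<open>l\<close> stays fixed.\<close>

lemma det_tridiagonal:
  fixes f :: "nat \<Rightarrow> nat \<Rightarrow> 'a::comm_ring_1"
  assumes f: "\<And>i j. i + 1 < j \<or> j + 1 < i \<Longrightarrow> f i j = 0"
  shows "det (mat (k + 2) (k + 2) (\<lambda>(i, j). f i j)) =
    f (k + 1) (k + 1) * det (mat (k + 1) (k + 1) (\<lambda>(i, j). f i j))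
    - f (k + 1) k * f k (k + 1) * det (mat k k (\<lambda>(i, j). f i j))"
proof -
  let ?M = "\<lambda>k. mat k k (\<lambda>(i, j). f i j)"
  let ?A = "?M (k + 2)"
  have A: "?A \<in> carrier_mat (k + 2) (k + 2)" by simp
  have d1: "mat_delete ?A (k + 1) (k + 1) = ?M (k + 1)"
    by (rule eq_matI) (auto simp: mat_delete_def)
  define B where "B = mat_delete ?A (k + 1) k"
  have B: "B \<in> carrier_mat (k + 1) (k + 1)" unfolding B_def using mat_delete_carrier[OF A] by simp
  have Bi: "B $$ (i, j) = f i (if j < k then j else Suc j)" if "i < k + 1" "j < k + 1" for i j
    using that unfolding B_def mat_delete_def by auto
  have d2: "mat_delete B k k = ?M k"
    by (rule eq_matI) (use B Bi in \<open>auto simp: mat_delete_def\<close>)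
  have "det B = (\<Sum>i<k + 1. B $$ (i, k) * cofactor B i k)"
    by (rule laplace_expansion_column[OF B]) simp
  also have "\<dots> = (\<Sum>i<k + 1. if i = k then f k (k + 1) * cofactor B k k else 0)"
    by (intro sum.cong refl) (auto simp: Bi f)
  also have "\<dots> = f k (k + 1) * det (?M k)" by (simp add: cofactor_def d2 mult_2[symmetric] power_mult)
  finally have dB: "det B = f k (k + 1) * det (?M k)" .
  have "det ?A = (\<Sum>j<k + 2. ?A $$ (k + 1, j) * cofactor ?A (k + 1) j)"
    by (rule laplace_expansion_row[OF A]) simp
  also have "\<dots> = (\<Sum>j<k + 2. (if j = k then f (k + 1) k * cofactor ?A (k + 1) k else 0)
      + (if j = k + 1 then f (k + 1) (k + 1) * cofactor ?A (k + 1) (k + 1) else 0))"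
    by (intro sum.cong refl) (auto simp: f)
  also have "\<dots> = f (k + 1) k * cofactor ?A (k + 1) k + f (k + 1) (k + 1) * cofactor ?A (k + 1) (k + 1)"
    by (simp add: sum.distrib)
  also have "cofactor ?A (k + 1) k = - det B"
    unfolding cofactor_def B_def by (simp add: mult_2[symmetric] power_mult)
  also have "cofactor ?A (k + 1) (k + 1) = det (?M (k + 1))"
    unfolding cofactor_def d1 by (simp add: mult_2[symmetric] power_mult)
  finally show ?thesis unfolding dB by (simp add: algebra_simps)
qed

lemma eval2_subst_y_continuant_Suc:
  "eval2 (subst_y [:0, 0, 1:] (continuant l (Suc k))) x y =
     (x - level l k) * eval2 (subst_y [:0, 0, 1:] (continuant l k)) x y
     - level l k * y^2 * eval2 (subst_y [:0, 0, 1:] (continuant l (k - 1))) x y"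
  unfolding eval2_subst_y unfolding eval2_altdef continuant_Suc by (simp add: algebra_simps power2_eq_square)

lemma det_shifted_H:
  "det (H l y + x \<cdot>\<^sub>m 1\<^sub>m l) = eval2 (spectral_poly l) x y"
proof -
  define f where "f i j = H_entry l y (i + 1) (j + 1) + (if i = j then x else 0)" for i j
  have f: "f i j = 0" if "i + 1 < j \<or> j + 1 < i" for i j
    using that by (auto simp: f_def H_entry_def)
  have diag: "f k k = x - level l k" for k
    by (simp add: f_def H_entry_def level_def algebra_simps)
  have off: "f (k + 1) k * f k (k + 1) = level l (k + 1) * y^2" for k
    by (simp add: f_def H_entry_def level_def algebra_simps power2_eq_square)
  \<comment> \<open>The entries are defined for all indices, so the induction over leading blocks
    needs no bound on \<open>k\<close> in terms of \<open>l\<close>.\<close>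
  have "det (mat k k (\<lambda>(i, j). f i j)) = eval2 (subst_y [:0, 0, 1:] (continuant l k)) x y" for k
  proof (induction k rule: less_induct)
    case (less k)
    consider "k = 0" | "k = 1" | m where "k = m + 2" by (metis add_2_eq_Suc' One_nat_def not0_implies_Suc)
    then show ?case
    proof cases
      case 1
      then show ?thesis by (simp add: eval2_subst_y)
    next
      case 2
      then show ?thesis using diag[of 0] unfolding 2 eval2_subst_y by (simp add: det_single eval2_altdef level_def)
    next
      case (3 m)
      have rec: "det (mat (m + 2) (m + 2) (\<lambda>(i, j). f i j)) =
        f (m + 1) (m + 1) * det (mat (m + 1) (m + 1) (\<lambda>(i, j). f i j))
        - f (m + 1) m * f m (m + 1) * det (mat m m (\<lambda>(i, j). f i j))"
        by (rule det_tridiagonal) (rule f)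
      have "det (mat k k (\<lambda>(i, j). f i j)) = (x - level l (m + 1)) * eval2 (subst_y [:0, 0, 1:] (continuant l (m + 1))) x y
          - level l (m + 1) * y^2 * eval2 (subst_y [:0, 0, 1:] (continuant l m)) x y"
        using less.IH[of "m + 1"] less.IH[of m] unfolding 3 rec diag off by simp
      then show ?thesis using eval2_subst_y_continuant_Suc[of l "m + 1" x y] by (simp add: 3)
    qed
  qed
  moreover have "H l y + x \<cdot>\<^sub>m 1\<^sub>m l = mat l l (\<lambda>(i, j). f i j)"
    by (rule eq_matI) (auto simp: H_def f_def)
  ultimately show ?thesis by (simp add: spectral_poly_def)
qed

theorem theorem1p3:
  fixes l :: nat
  assumes "l \<ge> 1"
  shows "algebraic_curve (Gamma l) \<and> irreducible_algebraic_set (Gamma l)"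
proof -
  let ?p = "spectral_poly l"
  have p: "prime_elem ?p" "lead_coeff ?p = 1" "degree ?p \<noteq> 0"
    using spectral_poly_prime[OF assms] subst_y_monic[of "continuant l l"] monic_continuant[of l l] assms
    unfolding spectral_poly_def by auto
  have V: "Gamma l = zero_set {?p}" by (simp add: Gamma_def zero_set_def det_shifted_H)
  have irr: "irreducible_algebraic_set (Gamma l)" unfolding V by (rule irreducible_zero_set[OF p])
  moreover have "algebraic_curve (Gamma l)"
    using irr p(2) V unfolding algebraic_curve_def irreducible_algebraic_set_def
    by (auto intro!: exI[of _ ?p])
  ultimately show ?thesis by simp
qed

end
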